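(* Let $\rho\in(0,1]$ and let $\mu$ be any source with maximal correlation $\rho$. Every (possibly partial) Boolean function $f$ that has $(1/3)$-error two-way (interactive) communication complexity $c$ bits with perfect (public) randomness has, for every $\delta>0$, a $\delta$-error zero-communication protocol with $\mu$-randomness using at most $2^{O(c)}\cdot\log(1/\delta)/\rho^2$ bits.
   Context: The maximal correlation of a distribution $\mu$ of $(X,Y)$ is $\sup\mathbb E[F(X)G(Y)]$ over real functions $F,G$ with $\mathbb E F(X)=\mathbb E G(Y)=0$ and $\mathrm{Var}\,F(X)=\mathrm{Var}\,G(Y)=1$. With $\mu$-randomness, Alice and Bob (who hold inputs $x$ and $y$) additionally receive respectively the $X$- and $Y$-components of arbitrarily many i.i.d. samples from $\mu$. A zero-communication (simultaneous message) protocol: Alice and Bob each send a single message, depending on their input and their randomness, to a referee, who outputs the answer; its cost is the total number of bits sent; it has $\delta$-error if on every input in the domain of $f$ the referee's output equals $f(x,y)$ with probability at least $1-\delta$.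
   Formalization: The bit bound is proved as max(1, 2^(20c)·log₂(1/δ)/ρ²): for δ ≤ 1/2 this is the stated bound, while for δ > 1/2, where log(1/δ) is near 0 or negative and the stated bound can fail, one bit is allowed. *)

theory Defs
  imports "HOL-Probability.Probability"
begin

text \<open>
  A source is a probability measure \<open>\<mu>\<close> on the product of two measurable spaces \<open>S\<close> and \<open>T\<close>;
  \<open>X\<close> and \<open>Y\<close> are the projections.  The supremum is taken in the extended reals, so that it is
  \<open>-\<infinity>\<close> when there is no admissible pair, i.e. when every measurable function of \<open>X\<close>, or every one
  of \<open>Y\<close>, is almost surely constant.
\<close>

definition standardized :: "'c measure \<Rightarrow> ('c \<Rightarrow> real) \<Rightarrow> bool" where
  "standardized M Z \<longleftrightarrow>
     integrable M (\<lambda>z. (Z z)\<^sup>2) \<and> prob_space.expectation M Z = 0 \<and> prob_space.variance M Z = 1"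

definition maximal_correlation :: "'a measure \<Rightarrow> 'b measure \<Rightarrow> ('a \<times> 'b) measure \<Rightarrow> ereal" where
  "maximal_correlation S T \<mu> =
     (SUP (F, G) \<in> {(F, G). F \<in> borel_measurable S \<and> G \<in> borel_measurable T \<and>
                          standardized \<mu> (\<lambda>z. F (fst z)) \<and> standardized \<mu> (\<lambda>z. G (snd z))}.
        ereal (prob_space.expectation \<mu> (\<lambda>z. F (fst z) * G (snd z))))"

text \<open>
  Deterministic two-way protocols as trees: at an inner node the named player announces one bit
  computed from his or her own input (the node is determined by the bits sent so far).
\<close>

datatype ('x, 'y) protocol =
    Answer bool
  | Alice "'x \<Rightarrow> bool" "('x, 'y) protocol" "('x, 'y) protocol"
  | Bob "'y \<Rightarrow> bool" "('x, 'y) protocol" "('x, 'y) protocol"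

primrec run :: "('x, 'y) protocol \<Rightarrow> 'x \<Rightarrow> 'y \<Rightarrow> bool" where
  "run (Answer v) x y = v"
| "run (Alice q l r) x y = (if q x then run r x y else run l x y)"
| "run (Bob q l r) x y = (if q y then run r x y else run l x y)"

primrec height :: "('x, 'y) protocol \<Rightarrow> nat" where
  "height (Answer v) = 0"
| "height (Alice q l r) = Suc (max (height l) (height r))"
| "height (Bob q l r) = Suc (max (height l) (height r))"

text \<open>
  A public-coin protocol is a probability distribution over deterministic protocols.  A partial
  Boolean function is a map into \<^typ>\<open>bool option\<close>; inputs outside its domain carry no
  requirement.
\<close>

definition public_coin_computes ::
    "real \<Rightarrow> ('x \<times> 'y \<rightharpoonup> bool) \<Rightarrow> ('x, 'y) protocol pmf \<Rightarrow> bool" where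
  "public_coin_computes \<epsilon> f P \<longleftrightarrow>
     (\<forall>x y v. f (x, y) = Some v \<longrightarrow> measure_pmf.prob P {t. run t x y = v} \<ge> 1 - \<epsilon>)"

definition public_coin_cost :: "('x, 'y) protocol pmf \<Rightarrow> enat" where
  "public_coin_cost P = (SUP t \<in> set_pmf P. enat (height t))"

definition public_coin_cc :: "real \<Rightarrow> ('x \<times> 'y \<rightharpoonup> bool) \<Rightarrow> enat" where
  "public_coin_cc \<epsilon> f = (INF P \<in> {P. public_coin_computes \<epsilon> f P}. public_coin_cost P)"

text \<open>
  Simultaneous-message protocols with \<open>\<mu>\<close>-randomness.  The protocol fixes a number \<open>N\<close> of i.i.d.
  samples; Alice sees only their first components, Bob only the second ones.  Both send
  bit strings of fixed lengths \<open>k\<close> and \<open>l\<close>.  Apart from the samples there is no randomness, neither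
  for the players nor for the referee.
\<close>

definition has_smp_protocol ::
    "'a measure \<Rightarrow> 'b measure \<Rightarrow> ('a \<times> 'b) measure \<Rightarrow> ('x \<times> 'y \<rightharpoonup> bool) \<Rightarrow> real \<Rightarrow> nat \<Rightarrow> bool" where
  "has_smp_protocol S T \<mu> f \<delta> bits \<longleftrightarrow>
     (\<exists>(N::nat) (k::nat) (l::nat) (alice :: 'x \<Rightarrow> (nat \<Rightarrow> 'a) \<Rightarrow> bool list)
        (bob :: 'y \<Rightarrow> (nat \<Rightarrow> 'b) \<Rightarrow> bool list) (referee :: bool list \<Rightarrow> bool list \<Rightarrow> bool).
        bits = k + l \<and>
        (\<forall>x. alice x \<in> measurable (PiM {..<N} (\<lambda>_. S)) (count_space UNIV)) \<and>
        (\<forall>y. bob y \<in> measurable (PiM {..<N} (\<lambda>_. T)) (count_space UNIV)) \<and>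
        (\<forall>x s. length (alice x s) = k) \<and>
        (\<forall>y t. length (bob y t) = l) \<and>
        (\<forall>x y v. f (x, y) = Some v \<longrightarrow>
           measure (PiM {..<N} (\<lambda>_. \<mu>))
             {\<omega> \<in> space (PiM {..<N} (\<lambda>_. \<mu>)).
                referee (alice x (\<lambda>i\<in>{..<N}. fst (\<omega> i))) (bob y (\<lambda>i\<in>{..<N}. snd (\<omega> i))) = v}
           \<ge> 1 - \<delta>))"

text \<open>
  The bound on the number of bits is stated with an explicit constant in the exponent of \<open>2^O(c)\<close>:
  an existentially quantified one could depend on the types of the inputs and of the samples.
  It is stated as \<open>max 1 (2^(20c) log(1/\<delta>) / \<rho>\<^sup>2)\<close>; the maximum is void for \<open>\<delta> \<le> 1/2\<close>, and for larger
  \<open>\<delta>\<close> it provides for values of \<open>log(1/\<delta>)\<close> that are close to \<open>0\<close> or negative.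
\<close>

end

theory Submission
  imports Defs
begin

text \<open>
  A deterministic protocol of height \<open>c\<close> splits the inputs into at most \<open>2^c\<close> rectangles, one per
  leaf, so its \<open>\<plusminus>1\<close>-valued answer is a sum of at most \<open>2^c\<close> products \<open>a(x) b(y)\<close> with values in
  \<open>{-1, 0, 1}\<close>. Replace the public coin by a long list of protocols with nearly the right
  frequencies and collect all terms \<open>(a\<^sub>j, b\<^sub>j)\<close> of the list. Every term gets its own fresh pair
  \<open>(X\<^sub>j, Y\<^sub>j)\<close> of symmetrised values of functions that almost attain the maximal correlation. With
  a small \<open>\<epsilon>\<close>, Alice forms \<open>A = \<epsilon> \<Sum> a\<^sub>j(x) X\<^sub>j\<close> and Bob \<open>B = \<epsilon> \<Sum> b\<^sub>j(y) Y\<^sub>j\<close>. Since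
  \<open>sin A sin B = (cos (A - B) - cos (A + B)) / 2\<close> and \<open>A \<plusminus> B\<close> are sums of independent symmetric
  variables, \<open>E (sin A sin B)\<close> is half the difference of two products of cosine moments. The two
  products differ by the factor \<open>exp (\<lambda> \<Sum> a\<^sub>j(x) b\<^sub>j(y))\<close> with a common \<open>\<lambda>\<close> of order \<open>\<rho> \<epsilon>\<^sup>2\<close>, whence
  the correlation has the sign of the correct answer and absolute value at least of order
  \<open>\<rho> 2^(-c)\<close>: no central limit theorem is needed. Each player rounds the sine to one bit, with
  private randomness taken from further samples, and the referee takes a majority vote over
  \<open>O(2^(2c) log (1/\<delta>) / \<rho>\<^sup>2)\<close> repetitions of comparing the two bits.
\<close>

subsection \<open>Finitely supported distributions\<close>

lemma expectation_pair_pmf: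
  fixes h :: "'a \<times> 'b \<Rightarrow> 'c :: {banach, second_countable_topology}"
  assumes "finite (set_pmf p)" and "finite (set_pmf q)"
  shows "measure_pmf.expectation (pair_pmf p q) h =
    measure_pmf.expectation p (\<lambda>x. measure_pmf.expectation q (\<lambda>y. h (x, y)))"
proof -
  have "pair_pmf p q = p \<bind> (\<lambda>x. map_pmf (Pair x) q)"
    by (simp add: pair_pmf_def map_pmf_def)
  then have "measure_pmf.expectation (pair_pmf p q) h =
      (\<Sum>x\<in>set_pmf p. pmf p x *\<^sub>R measure_pmf.expectation q (\<lambda>y. h (x, y)))"
    using assms by (simp add: pmf_expectation_bind[of "set_pmf p"])
  also have "\<dots> = measure_pmf.expectation p (\<lambda>x. measure_pmf.expectation q (\<lambda>y. h (x, y)))"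
    using assms by (intro integral_measure_pmf[symmetric]) auto
  finally show ?thesis .
qed

lemma expectation_pair_pmf_mult:
  fixes f :: "'a \<Rightarrow> 'c :: {real_normed_field, banach, second_countable_topology}"
  assumes "finite (set_pmf p)" and "finite (set_pmf q)"
  shows "measure_pmf.expectation (pair_pmf p q) (\<lambda>z. f (fst z) * g (snd z)) =
    measure_pmf.expectation p f * measure_pmf.expectation q g"
  using assms by (simp add: expectation_pair_pmf)

lemma replicate_pmf_Suc_pair:
  "replicate_pmf (Suc n) p = map_pmf (\<lambda>(x, xs). x # xs) (pair_pmf p (replicate_pmf n p))"
  by (simp add: pair_pmf_def map_pmf_def bind_assoc_pmf bind_return_pmf)

lemma finite_set_replicate_pmf:
  assumes "finite (set_pmf p)"
  shows "finite (set_pmf (replicate_pmf n p))"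
  using finite_lists_length_eq[OF assms, of n]
  by (simp add: set_replicate_pmf in_lists_conv_set subset_iff conj_commute Ball_def)

lemma map_replicate_pmf: "map_pmf (map g) (replicate_pmf n p) = replicate_pmf n (map_pmf g p)"
proof (induction n)
  case (Suc n)
  show ?case
    unfolding replicate_pmf.simps Suc.IH[symmetric] by (simp add: map_bind_pmf bind_map_pmf)
qed simp

lemma pmf_replicate_pmf:
  "pmf (replicate_pmf n p) xs = (if length xs = n then \<Prod>x\<leftarrow>xs. pmf p x else 0)"
proof (induction n arbitrary: xs)
  case 0
  show ?case by (cases xs) (auto simp: pmf_return)
next
  case (Suc n)
  show ?case
  proof (cases xs)
    case Nil
    then have "xs \<notin> set_pmf (replicate_pmf (Suc n) p)"
      unfolding set_replicate_pmf by simp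
    then show ?thesis using Nil by (simp add: set_pmf_iff del: replicate_pmf.simps)
  next
    case (Cons y ys)
    have "pmf (replicate_pmf (Suc n) p) xs = pmf (pair_pmf p (replicate_pmf n p)) (y, ys)"
      unfolding replicate_pmf_Suc_pair Cons
      using pmf_map_inj'[of "\<lambda>(x, xs). x # xs" _ "(y, ys)"] by (simp add: inj_def)
    then show ?thesis using Suc.IH[of ys] Cons by (simp add: pmf_pair)
  qed
qed

lemma expectation_replicate_pmf_prod_zip:
  fixes \<phi>s :: "('a \<Rightarrow> 'c :: {real_normed_field, banach, second_countable_topology}) list"
  assumes fin: "finite (set_pmf p)"
  shows "measure_pmf.expectation (replicate_pmf (length \<phi>s) p) (\<lambda>zs. \<Prod>(\<phi>, z)\<leftarrow>zip \<phi>s zs. \<phi> z) =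
    (\<Prod>\<phi>\<leftarrow>\<phi>s. measure_pmf.expectation p \<phi>)"
proof (induction \<phi>s)
  case (Cons \<phi> \<phi>s)
  have "measure_pmf.expectation (replicate_pmf (length (\<phi> # \<phi>s)) p)
      (\<lambda>zs. \<Prod>(\<phi>, z)\<leftarrow>zip (\<phi> # \<phi>s) zs. \<phi> z) =
    measure_pmf.expectation (pair_pmf p (replicate_pmf (length \<phi>s) p))
      (\<lambda>z. \<phi> (fst z) * (\<Prod>(\<phi>, z)\<leftarrow>zip \<phi>s (snd z). \<phi> z))"
    unfolding length_Cons replicate_pmf_Suc_pair by (simp add: case_prod_unfold)
  also have "\<dots> = measure_pmf.expectation p \<phi> * (\<Prod>\<phi>\<leftarrow>\<phi>s. measure_pmf.expectation p \<phi>)"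
    using expectation_pair_pmf_mult[OF fin finite_set_replicate_pmf[OF fin],
        of _ \<phi> "\<lambda>zs. \<Prod>(\<phi>, z)\<leftarrow>zip \<phi>s zs. \<phi> z"] Cons.IH by simp
  finally show ?case by simp
qed simp

subsection \<open>Samples shared by two players\<close>

definition iid_views :: "nat \<Rightarrow> ('s \<times> 't) pmf \<Rightarrow> ('s list \<times> 't list) pmf" where
  "iid_views n p = map_pmf (\<lambda>zs. (map fst zs, map snd zs)) (replicate_pmf n p)"

definition pair_views :: "('a \<times> 'b) pmf \<Rightarrow> ('c \<times> 'd) pmf \<Rightarrow> (('a \<times> 'c) \<times> ('b \<times> 'd)) pmf" where
  "pair_views p q = map_pmf (\<lambda>((a, b), (c, d)). ((a, c), (b, d))) (pair_pmf p q)"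

lemma iid_views_0: "iid_views 0 p = return_pmf ([], [])"
  by (simp add: iid_views_def)

lemma iid_views_1: "iid_views 1 p = map_pmf (map_prod (\<lambda>a. [a]) (\<lambda>b. [b])) p"
  unfolding iid_views_def replicate_pmf_1 map_pmf_comp by (rule map_pmf_cong) auto

lemma iid_views_add:
  "iid_views (m + n) p = map_pmf (map_prod (\<lambda>(as, cs). as @ cs) (\<lambda>(bs, ds). bs @ ds))
    (pair_views (iid_views m p) (iid_views n p))"
  by (simp add: iid_views_def pair_views_def replicate_pmf_distrib pair_pmf_def map_pmf_def
      bind_assoc_pmf bind_return_pmf)

lemma length_iid_views:
  assumes "(as, bs) \<in> set_pmf (iid_views n p)"
  shows "length as = n \<and> length bs = n"
  using assms by (auto simp: iid_views_def set_replicate_pmf)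

lemma finite_set_iid_views:
  assumes "finite (set_pmf p)"
  shows "finite (set_pmf (iid_views n p))"
  using finite_set_replicate_pmf[OF assms] by (simp add: iid_views_def)

lemma map_fst_iid_views: "map_pmf fst (iid_views n p) = replicate_pmf n (map_pmf fst p)"
  by (simp add: iid_views_def map_pmf_comp flip: map_replicate_pmf)

lemma map_snd_iid_views: "map_pmf snd (iid_views n p) = replicate_pmf n (map_pmf snd p)"
  by (simp add: iid_views_def map_pmf_comp flip: map_replicate_pmf)

text \<open>The number of samples may not depend on the inputs, hence the order of the quantifiers.\<close>

definition simulates :: "('s \<times> 't) pmf \<Rightarrow> ('x \<Rightarrow> 'y \<Rightarrow> ('m \<times> 'n) pmf) \<Rightarrow> bool" where
  "simulates p D \<longleftrightarrow>
    (\<exists>N \<alpha> \<beta>. \<forall>x y. D x y = map_pmf (map_prod (\<alpha> x) (\<beta> y)) (iid_views N p))"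

lemma simulates_iid_views: "simulates p (\<lambda>_ _. iid_views n p)"
  unfolding simulates_def
  by (intro exI[of _ n] exI[of _ "\<lambda>_. id"]) (simp add: prod.map_id0 map_pmf_id[unfolded id_def])

lemma simulates_map_prod:
  assumes "simulates p D"
  shows "simulates p (\<lambda>x y. map_pmf (map_prod (g x) (h y)) (D x y))"
proof -
  obtain N \<alpha> \<beta> where "\<And>x y. D x y = map_pmf (map_prod (\<alpha> x) (\<beta> y)) (iid_views N p)"
    using assms unfolding simulates_def by blast
  then show ?thesis
    unfolding simulates_def
    by (intro exI[of _ N] exI[of _ "\<lambda>x. g x \<circ> \<alpha> x"] exI[of _ "\<lambda>y. h y \<circ> \<beta> y"])
      (simp add: map_pmf_comp prod.map_comp)
qed

lemma simulates_return: "simulates p (\<lambda>_ _. return_pmf (a, b))"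
  using simulates_map_prod[OF simulates_iid_views[of p 0], of "\<lambda>_ _. a" "\<lambda>_ _. b"]
  by (simp add: iid_views_0)

lemma simulates_source: "simulates p (\<lambda>_ _. p)"
  using simulates_map_prod[OF simulates_iid_views[of p 1], of "\<lambda>_. hd" "\<lambda>_. hd"]
  unfolding iid_views_1 by (simp add: map_pmf_comp prod.map_comp o_def prod.map_ident)

lemma simulates_pair_views:
  assumes "simulates p D" and "simulates p E"
  shows "simulates p (\<lambda>x y. pair_views (D x y) (E x y))"
proof -
  obtain M \<alpha> \<beta> where D: "\<And>x y. D x y = map_pmf (map_prod (\<alpha> x) (\<beta> y)) (iid_views M p)"
    using assms(1) unfolding simulates_def by blast
  obtain N \<gamma> \<delta> where E: "\<And>x y. E x y = map_pmf (map_prod (\<gamma> x) (\<delta> y)) (iid_views N p)"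
    using assms(2) unfolding simulates_def by blast
  have "pair_views (D x y) (E x y) = map_pmf (map_prod (\<lambda>ss. (\<alpha> x (take M ss), \<gamma> x (drop M ss)))
      (\<lambda>ts. (\<beta> y (take M ts), \<delta> y (drop M ts)))) (iid_views (M + N) p)" for x y
    unfolding D E iid_views_add pair_views_def pair_map_pmf1 pair_map_pmf2 map_pmf_comp
    by (rule map_pmf_cong) (auto dest!: length_iid_views)
  then show ?thesis
    unfolding simulates_def
    by (intro exI[of _ "M + N"] exI[of _ "\<lambda>x ss. (\<alpha> x (take M ss), \<gamma> x (drop M ss))"]
        exI[of _ "\<lambda>y ts. (\<beta> y (take M ts), \<delta> y (drop M ts))"]) blast
qed

lemma simulates_iid_views_of:
  assumes "simulates p D"
  shows "simulates p (\<lambda>x y. iid_views n (D x y))"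
proof (induction n)
  case 0
  show ?case unfolding iid_views_0 by (rule simulates_return)
next
  case (Suc n)
  have "simulates p (\<lambda>x y. iid_views 1 (D x y))"
    unfolding iid_views_1 by (rule simulates_map_prod[OF assms])
  from simulates_map_prod[OF simulates_pair_views[OF this Suc.IH]]
  show ?case unfolding Suc_eq_plus1_left iid_views_add .
qed

lemma finite_set_pmf_if_simulates:
  assumes "simulates p D" and "finite (set_pmf p)"
  shows "finite (set_pmf (D x y))"
proof -
  obtain N \<alpha> \<beta> where "\<And>x y. D x y = map_pmf (map_prod (\<alpha> x) (\<beta> y)) (iid_views N p)"
    using assms(1) unfolding simulates_def by blast
  then show ?thesis using finite_set_iid_views[OF assms(2)] by simp
qed

subsection \<open>Majority votes\<close>

definition spin :: "bool \<Rightarrow> real" where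
  "spin b = (if b then 1 else -1)"

lemma spin_mult: "spin a * spin b = spin (a = b)"
  by (simp add: spin_def)

lemma abs_spin [simp]: "\<bar>spin b\<bar> = 1"
  by (simp add: spin_def)

lemma expectation_spin_Collect:
  "measure_pmf.expectation p (\<lambda>z. spin (P z)) = 2 * measure_pmf.prob p {z. P z} - 1"
proof -
  have "measure_pmf.expectation p (\<lambda>z. spin (P z)) =
      measure_pmf.expectation p (\<lambda>z. 2 * indicator {z. P z} z - 1)"
    by (intro Bochner_Integration.integral_cong) (auto simp: spin_def)
  also have "\<dots> = 2 * measure_pmf.prob p {z. P z} - 1"
    by (subst Bochner_Integration.integral_diff) (auto simp: measure_pmf.emeasure_eq_measure)
  finally show ?thesis .
qed

lemma prob_Collect_not: "measure_pmf.prob p {z. \<not> P z} = 1 - measure_pmf.prob p {z. P z}"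
  using measure_pmf.prob_compl[of "{z. P z}" p] by (simp add: Compl_eq_Diff_UNIV Collect_neg_eq)

definition majority :: "bool list \<Rightarrow> bool" where
  "majority bs \<longleftrightarrow> length bs < 2 * length (filter id bs)"

lemma majority_eq_if_count_gt:
  assumes "length bs < 2 * length (filter (\<lambda>b. b = v) bs)"
  shows "majority bs = v"
  using assms sum_length_filter_compl[of id bs] by (cases v) (auto simp: majority_def id_def)

lemma map_pmf_eq_bernoulli_pmf: "map_pmf (\<lambda>z. P z) p = bernoulli_pmf (measure_pmf.prob p {z. P z})"
proof (rule pmf_eqI)
  fix b
  show "pmf (map_pmf P p) b = pmf (bernoulli_pmf (measure_pmf.prob p {z. P z})) b"
    by (cases b) (simp_all add: pmf_map vimage_def prob_Collect_not)
qed

lemma map_pmf_length_filter_replicate_pmf: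
  "map_pmf (\<lambda>xs. length (filter P xs)) (replicate_pmf n p) =
    binomial_pmf n (measure_pmf.prob p {x. P x})"
  by (simp add: binomial_pmf_altdef filter_map o_def map_pmf_comp
      flip: map_pmf_eq_bernoulli_pmf map_replicate_pmf)

lemma prob_majority_ge:
  fixes p :: "bool pmf"
  assumes "0 \<le> m" and mean: "m \<le> spin v * measure_pmf.expectation p spin"
  shows "1 - exp (- (m\<^sup>2 * real n / 2)) \<le> measure_pmf.prob (replicate_pmf n p) {bs. majority bs = v}"
proof (cases "n = 0")
  case False
  define q where "q = measure_pmf.prob p {b. b = v}"
  have "spin v * measure_pmf.expectation p spin = 2 * q - 1"
    unfolding q_def expectation_spin_Collect[symmetric]
    by (simp add: spin_mult eq_commute flip: integral_mult_right_zero)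
  then have q: "(1 + m) / 2 \<le> q" using mean by simp
  interpret binomial_distribution n q by unfold_locales (simp add: q_def)
  define count where "count bs = length (filter (\<lambda>b. b = v) bs)" for bs
  have "measure_pmf.prob (replicate_pmf n p) {bs. majority bs \<noteq> v} \<le>
      measure_pmf.prob (replicate_pmf n p) {bs. real (count bs) \<le> n * q - n * m / 2}"
  proof (rule measure_pmf.finite_measure_mono_AE, rule AE_pmfI, rule impI)
    fix bs assume "bs \<in> set_pmf (replicate_pmf n p)" and "bs \<in> {bs. majority bs \<noteq> v}"
    then have "2 * count bs \<le> n"
      using majority_eq_if_count_gt[of bs v] by (force simp: set_replicate_pmf count_def)
    moreover have "real n * ((1 + m) / 2) \<le> real n * q" using q by (intro mult_left_mono) auto
    ultimately show "bs \<in> {bs. real (count bs) \<le> n * q - n * m / 2}" by (simp add: field_simps)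
  qed simp
  also have "\<dots> = measure_pmf.prob (binomial_pmf n q) {k. real k \<le> n * q - n * m / 2}"
    unfolding q_def map_pmf_length_filter_replicate_pmf[symmetric]
    by (simp add: vimage_def count_def)
  also have "\<dots> \<le> exp (- 2 * (n * m / 2)\<^sup>2 / n)"
    using False \<open>0 \<le> m\<close> by (intro prob_le) auto
  also have "- 2 * (n * m / 2)\<^sup>2 / n = - (m\<^sup>2 * real n / 2)"
    using False by (simp add: power2_eq_square field_simps)
  finally show ?thesis unfolding prob_Collect_not by simp
qed simp

subsection \<open>Randomized rounding\<close>

lemma ex_subset_sum_approx:
  fixes w :: "'a \<Rightarrow> real"
  assumes "finite A" and "\<And>a. a \<in> A \<Longrightarrow> 0 \<le> w a \<and> w a \<le> \<eta>" and "0 \<le> \<eta>"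
    and "0 \<le> q" and "q \<le> sum w A"
  shows "\<exists>B\<subseteq>A. \<bar>sum w B - q\<bar> \<le> \<eta>"
  using assms
proof (induction A rule: finite_induct)
  case (insert a A)
  show ?case
  proof (cases "q \<le> sum w A")
    case True
    then obtain B where "B \<subseteq> A" "\<bar>sum w B - q\<bar> \<le> \<eta>" using insert by auto
    then show ?thesis by blast
  next
    case False
    then have "\<bar>sum w A - q\<bar> \<le> \<eta>" using insert.prems(1)[of a] insert.prems(4) insert.hyps by auto
    then show ?thesis by blast
  qed
qed auto

lemma ex_event_prob_approx:
  fixes p :: "'a pmf"
  assumes "finite (set_pmf p)" and "\<And>x. pmf p x \<le> \<eta>" and "0 \<le> q" and "q \<le> 1"
  shows "\<exists>W. \<bar>measure_pmf.prob p W - q\<bar> \<le> \<eta>"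
proof -
  have "0 \<le> \<eta>" using order_trans[OF pmf_nonneg assms(2)] .
  moreover have "sum (pmf p) (set_pmf p) = 1" using assms(1) by (simp add: sum_pmf_eq_1)
  ultimately obtain W where "W \<subseteq> set_pmf p" "\<bar>sum (pmf p) W - q\<bar> \<le> \<eta>"
    using ex_subset_sum_approx[of "set_pmf p" "pmf p" \<eta> q] assms by auto
  moreover have "measure_pmf.prob p W = sum (pmf p) W"
    using \<open>W \<subseteq> set_pmf p\<close> assms(1) by (intro measure_measure_pmf_finite) (rule finite_subset)
  ultimately show ?thesis by (intro exI[of _ W]) simp
qed

lemma pmf_eq_1_imp_return_pmf:
  assumes "pmf p x = 1"
  shows "p = return_pmf x"
proof -
  have "measure_pmf.prob p {x} = 1" using assms by (simp add: measure_pmf_single)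
  then have "set_pmf p \<subseteq> {x}" by (subst (asm) measure_pmf.prob_eq_1) (auto simp: AE_measure_pmf_iff)
  then show ?thesis by (simp add: set_pmf_subset_singleton)
qed

lemma ex_replicate_pmf_atoms_le:
  assumes fin: "finite (set_pmf p)" and nonconst: "\<And>x. p \<noteq> return_pmf x" and "0 < \<eta>"
  shows "\<exists>n. \<forall>xs. pmf (replicate_pmf n p) xs \<le> \<eta>"
proof -
  define r where "r = Max (pmf p ` set_pmf p)"
  have "r \<in> pmf p ` set_pmf p"
    unfolding r_def using fin set_pmf_not_empty[of p] by (intro Max_in) auto
  then obtain x where x: "r = pmf p x" by blast
  have "r \<noteq> 1" using pmf_eq_1_imp_return_pmf[of p x] nonconst[of x] by (auto simp: x)
  moreover have "0 \<le> r" "r \<le> 1" by (simp_all add: x pmf_le_1)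
  ultimately obtain n where n: "r ^ n < \<eta>"
    using real_arch_pow_inv[of \<eta> r] \<open>0 < \<eta>\<close> by auto
  have le_r: "pmf p x \<le> r" for x
    using fin \<open>0 \<le> r\<close> by (cases "x \<in> set_pmf p") (auto simp: r_def set_pmf_iff)
  have "(\<Prod>x\<leftarrow>xs. pmf p x) \<le> r ^ length xs" for xs
    using le_r \<open>0 \<le> r\<close> by (induction xs) (auto intro!: mult_mono prod_list_nonneg)
  then have "pmf (replicate_pmf n p) xs \<le> r ^ n" for xs
    using \<open>0 \<le> r\<close> unfolding pmf_replicate_pmf by auto
  then show ?thesis using n by (intro exI[of _ n]) (auto intro: order_trans less_imp_le)
qed

lemma ex_randomized_rounding:
  assumes fin: "finite (set_pmf p)" and nonconst: "\<And>x. p \<noteq> return_pmf x" and "0 < \<eta>"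
  obtains n W where "\<And>u. \<bar>u\<bar> \<le> 1 \<Longrightarrow>
    \<bar>measure_pmf.expectation (replicate_pmf n p) (\<lambda>zs. spin (zs \<in> W u)) - u\<bar> \<le> \<eta>"
proof -
  obtain n where n: "\<And>xs. pmf (replicate_pmf n p) xs \<le> \<eta> / 2"
    using ex_replicate_pmf_atoms_le[OF fin nonconst, of "\<eta> / 2"] \<open>0 < \<eta>\<close> by auto
  have "\<exists>W. \<bar>measure_pmf.prob (replicate_pmf n p) W - (1 + u) / 2\<bar> \<le> \<eta> / 2" if "\<bar>u\<bar> \<le> 1" for u
    using that by (intro ex_event_prob_approx finite_set_replicate_pmf fin n) auto
  then obtain W where
    "\<And>u. \<bar>u\<bar> \<le> 1 \<Longrightarrow> \<bar>measure_pmf.prob (replicate_pmf n p) (W u) - (1 + u) / 2\<bar> \<le> \<eta> / 2"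
    by metis
  then have "\<bar>measure_pmf.expectation (replicate_pmf n p) (\<lambda>zs. spin (zs \<in> W u)) - u\<bar> \<le> \<eta>"
    if "\<bar>u\<bar> \<le> 1" for u
    using that unfolding expectation_spin_Collect by (force simp: abs_le_iff field_simps)
  then show ?thesis by (rule that)
qed

lemma abs_mult_diff_le:
  fixes a b u w :: real
  assumes "\<bar>a\<bar> \<le> 1" and "\<bar>w\<bar> \<le> 1"
  shows "\<bar>a * b - u * w\<bar> \<le> \<bar>a - u\<bar> + \<bar>b - w\<bar>"
proof -
  have "a * b - u * w = a * (b - w) + (a - u) * w" by (simp add: algebra_simps)
  then have "\<bar>a * b - u * w\<bar> \<le> \<bar>a\<bar> * \<bar>b - w\<bar> + \<bar>a - u\<bar> * \<bar>w\<bar>"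
    by (metis abs_mult abs_triangle_ineq)
  also have "\<dots> \<le> 1 * \<bar>b - w\<bar> + \<bar>a - u\<bar> * 1"
    using assms by (intro add_mono mult_mono) auto
  finally show ?thesis by simp
qed

lemma abs_expectation_mult_diff_le:
  fixes \<phi> \<psi> :: "real \<Rightarrow> real" and q :: "(real \<times> real) pmf"
  assumes fin: "finite (set_pmf q)"
    and bounded: "\<And>u w. (u, w) \<in> set_pmf q \<Longrightarrow> \<bar>u\<bar> \<le> 1 \<and> \<bar>w\<bar> \<le> 1"
    and \<phi>: "\<And>u. \<bar>u\<bar> \<le> 1 \<Longrightarrow> \<bar>\<phi> u\<bar> \<le> 1 \<and> \<bar>\<phi> u - u\<bar> \<le> \<eta>"
    and \<psi>: "\<And>w. \<bar>w\<bar> \<le> 1 \<Longrightarrow> \<bar>\<psi> w - w\<bar> \<le> \<eta>"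
  shows "\<bar>measure_pmf.expectation q (\<lambda>(u, w). \<phi> u * \<psi> w) -
    measure_pmf.expectation q (\<lambda>(u, w). u * w)\<bar> \<le> 2 * \<eta>"
proof -
  note I = integrable_measure_pmf_finite[OF fin]
  have "\<bar>measure_pmf.expectation q (\<lambda>(u, w). \<phi> u * \<psi> w) - measure_pmf.expectation q (\<lambda>(u, w). u * w)\<bar> =
      \<bar>measure_pmf.expectation q (\<lambda>(u, w). \<phi> u * \<psi> w - u * w)\<bar>"
    by (simp add: I case_prod_unfold)
  also have "\<dots> \<le> measure_pmf.expectation q (\<lambda>(u, w). \<bar>\<phi> u * \<psi> w - u * w\<bar>)"
    using integral_abs_bound[of q "\<lambda>(u, w). \<phi> u * \<psi> w - u * w"] by (simp add: case_prod_unfold)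
  also have "\<dots> \<le> measure_pmf.expectation q (\<lambda>_. 2 * \<eta>)"
  proof (rule integral_mono_AE[OF I I], rule AE_pmfI, clarify)
    fix u w assume "(u, w) \<in> set_pmf q"
    then have uw: "\<bar>u\<bar> \<le> 1" "\<bar>w\<bar> \<le> 1" using bounded by blast+
    have "\<bar>\<phi> u * \<psi> w - u * w\<bar> \<le> \<bar>\<phi> u - u\<bar> + \<bar>\<psi> w - w\<bar>"
      using \<phi> uw by (intro abs_mult_diff_le) auto
    also have "\<dots> \<le> 2 * \<eta>" using \<phi>[OF uw(1)] \<psi>[OF uw(2)] by simp
    finally show "\<bar>\<phi> u * \<psi> w - u * w\<bar> \<le> 2 * \<eta>" .
  qed
  finally show ?thesis by simp
qed

lemma ex_simulates_rounding:
  fixes p :: "('s \<times> 't) pmf" and K :: "'x \<Rightarrow> 'y \<Rightarrow> (real \<times> real) pmf"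
  assumes fin: "finite (set_pmf p)"
    and nonconst: "\<And>s. map_pmf fst p \<noteq> return_pmf s" "\<And>t. map_pmf snd p \<noteq> return_pmf t"
    and K: "simulates p K"
    and bounded: "\<forall>x y u w. (u, w) \<in> set_pmf (K x y) \<longrightarrow> \<bar>u\<bar> \<le> 1 \<and> \<bar>w\<bar> \<le> 1"
    and "0 < \<eta>"
  shows "\<exists>D :: 'x \<Rightarrow> 'y \<Rightarrow> (bool \<times> bool) pmf. simulates p D \<and>
    (\<forall>x y. \<bar>measure_pmf.expectation (D x y) (\<lambda>(a, b). spin a * spin b) -
      measure_pmf.expectation (K x y) (\<lambda>(u, w). u * w)\<bar> \<le> 2 * \<eta>)"
proof -
  obtain m V where V: "\<And>u. \<bar>u\<bar> \<le> 1 \<Longrightarrow>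
      \<bar>measure_pmf.expectation (replicate_pmf m (map_pmf fst p)) (\<lambda>ss. spin (ss \<in> V u)) - u\<bar> \<le> \<eta>"
    using ex_randomized_rounding[of "map_pmf fst p" \<eta>] fin nonconst(1) \<open>0 < \<eta>\<close> by auto
  obtain n W where W: "\<And>w. \<bar>w\<bar> \<le> 1 \<Longrightarrow>
      \<bar>measure_pmf.expectation (replicate_pmf n (map_pmf snd p)) (\<lambda>ts. spin (ts \<in> W w)) - w\<bar> \<le> \<eta>"
    using ex_randomized_rounding[of "map_pmf snd p" \<eta>] fin nonconst(2) \<open>0 < \<eta>\<close> by auto
  define \<phi> where "\<phi> u = measure_pmf.expectation (iid_views m p) (\<lambda>z. spin (fst z \<in> V u))" for u
  define \<psi> where "\<psi> w = measure_pmf.expectation (iid_views n p) (\<lambda>z. spin (snd z \<in> W w))" for w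
  have \<phi>: "\<bar>\<phi> u\<bar> \<le> 1 \<and> \<bar>\<phi> u - u\<bar> \<le> \<eta>" if "\<bar>u\<bar> \<le> 1" for u
    using V[OF that]
    by (simp add: \<phi>_def expectation_spin_Collect abs_le_iff vimage_def flip: map_fst_iid_views)
  have \<psi>: "\<bar>\<psi> w - w\<bar> \<le> \<eta>" if "\<bar>w\<bar> \<le> 1" for w
    using W[OF that] by (simp add: \<psi>_def flip: map_snd_iid_views)
  define D where "D x y = map_pmf (map_prod (\<lambda>(u, ss, ss'). ss \<in> V u) (\<lambda>(w, ts, ts'). ts' \<in> W w))
      (pair_views (K x y) (pair_views (iid_views m p) (iid_views n p)))" for x y
  have "simulates p D"
    unfolding D_def by (intro simulates_map_prod simulates_pair_views K simulates_iid_views)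
  moreover have "\<bar>measure_pmf.expectation (D x y) (\<lambda>(a, b). spin a * spin b) -
      measure_pmf.expectation (K x y) (\<lambda>(u, w). u * w)\<bar> \<le> 2 * \<eta>" for x y
  proof -
    note finK = finite_set_pmf_if_simulates[OF K fin]
    have "measure_pmf.expectation (D x y) (\<lambda>(a, b). spin a * spin b) =
        measure_pmf.expectation (K x y) (\<lambda>(u, w). \<phi> u * \<psi> w)"
      using finK finite_set_iid_views[OF fin]
      by (simp add: D_def \<phi>_def \<psi>_def pair_views_def pair_map_pmf2 case_prod_unfold
          expectation_pair_pmf)
    then show ?thesis using abs_expectation_mult_diff_le[OF finK bounded[rule_format] \<phi> \<psi>] by simp
  qed
  ultimately show ?thesis by blast
qed

subsection \<open>Covariance and symmetrization\<close>

definition covariance :: "'a measure \<Rightarrow> ('a \<Rightarrow> real) \<Rightarrow> ('a \<Rightarrow> real) \<Rightarrow> real" where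
  "covariance M f g = integral\<^sup>L M (\<lambda>z. f z * g z) - integral\<^sup>L M f * integral\<^sup>L M g"

lemma covariance_commute: "covariance M f g = covariance M g f"
  by (simp add: covariance_def mult.commute)

lemma covariance_self_le: "covariance M f f \<le> integral\<^sup>L M (\<lambda>z. (f z)\<^sup>2)"
  by (simp add: covariance_def power2_eq_square)

lemma covariance_eq_0_if_map_pmf_eq_return_pmf:
  assumes "map_pmf f p = return_pmf c"
  shows "covariance p f g = 0"
proof -
  have "f z = c" if "z \<in> set_pmf p" for z
    using that arg_cong[OF assms, of set_pmf] by auto
  then have "AE z in p. f z = c" by (rule AE_pmfI)
  then have "measure_pmf.expectation p f = measure_pmf.expectation p (\<lambda>_. c)"
    and "measure_pmf.expectation p (\<lambda>z. f z * g z) = measure_pmf.expectation p (\<lambda>z. c * g z)"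
    by (intro integral_cong_AE; auto)+
  then show ?thesis by (simp add: covariance_def)
qed

definition symmetrize :: "'a :: ab_group_add pmf \<Rightarrow> 'a pmf" where
  "symmetrize p = map_pmf (\<lambda>(z, z'). z - z') (pair_pmf p p)"

lemma map_uminus_symmetrize: "map_pmf uminus (symmetrize p) = symmetrize p"
proof -
  have "map_pmf uminus (symmetrize p) =
      map_pmf (\<lambda>(z, z'). z - z') (map_pmf (\<lambda>(z, z'). (z', z)) (pair_pmf p p))"
    by (simp add: symmetrize_def map_pmf_comp case_prod_unfold)
  then show ?thesis by (simp add: symmetrize_def flip: pair_commute_pmf)
qed

lemma expectation_odd_eq_0:
  fixes h :: "'a :: ab_group_add \<Rightarrow> real"
  assumes "map_pmf uminus p = p" and "\<And>z. h (- z) = - h z"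
  shows "measure_pmf.expectation p h = 0"
proof -
  have "measure_pmf.expectation p h = measure_pmf.expectation (map_pmf uminus p) h"
    by (simp only: assms(1))
  also have "\<dots> = - measure_pmf.expectation p h" by (simp add: assms(2))
  finally show ?thesis by simp
qed

lemma finite_set_symmetrize: "finite (set_pmf p) \<Longrightarrow> finite (set_pmf (symmetrize p))"
  by (simp add: symmetrize_def)

lemma simulates_symmetrize:
  fixes p :: "('s :: ab_group_add \<times> 't :: ab_group_add) pmf"
  shows "simulates p (\<lambda>_ _. symmetrize p)"
proof -
  have "symmetrize p = map_pmf (map_prod (\<lambda>(a, c). a - c) (\<lambda>(b, d). b - d)) (pair_views p p)"
    unfolding symmetrize_def pair_views_def map_pmf_comp by (rule map_pmf_cong) auto
  then show ?thesis
    using simulates_map_prod[OF simulates_pair_views[OF simulates_source simulates_source]] by simp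
qed

lemma expectation_pair_pmf_diff_mult_diff:
  assumes fin: "finite (set_pmf p)"
  shows "measure_pmf.expectation (pair_pmf p p) (\<lambda>(z, z'). (f z - f z') * (g z - g z')) =
    2 * covariance p f g"
proof -
  have fin2: "finite (set_pmf (pair_pmf p p))" using fin by simp
  note integrable_measure_pmf_finite[OF fin2, simp]
  have "measure_pmf.expectation (pair_pmf p p) (\<lambda>(z, z'). (f z - f z') * (g z - g z')) =
      measure_pmf.expectation (pair_pmf p p) (\<lambda>z. f (fst z) * g (fst z) + f (snd z) * g (snd z)
       - (f (fst z) * g (snd z) + g (fst z) * f (snd z)))"
    by (intro Bochner_Integration.integral_cong) (auto simp: algebra_simps)
  also have "\<dots> = 2 * covariance p f g"
    using expectation_pair_pmf_fst[of p p "\<lambda>z. f z * g z"]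
      expectation_pair_pmf_snd[of p p "\<lambda>z. f z * g z"]
    by (simp add: expectation_pair_pmf_mult[OF fin fin] covariance_def)
  finally show ?thesis .
qed

lemma expectation_symmetrize_fst_mult_snd:
  fixes p :: "(real \<times> real) pmf"
  assumes "finite (set_pmf p)"
  shows "measure_pmf.expectation (symmetrize p) (\<lambda>z. fst z * snd z) = 2 * covariance p fst snd"
  using expectation_pair_pmf_diff_mult_diff[OF assms, of fst snd]
  by (simp add: symmetrize_def case_prod_unfold)

definition second_moments_le :: "(real \<times> real) pmf \<Rightarrow> real \<Rightarrow> bool" where
  "second_moments_le p s \<longleftrightarrow> measure_pmf.expectation p (\<lambda>z. (fst z)\<^sup>2) \<le> s \<and>
    measure_pmf.expectation p (\<lambda>z. (snd z)\<^sup>2) \<le> s"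

lemma second_moments_le_symmetrize:
  assumes "finite (set_pmf p)" and "second_moments_le p s"
  shows "second_moments_le (symmetrize p) (2 * s)"
  using assms(2) covariance_self_le[of p fst] covariance_self_le[of p snd]
    expectation_pair_pmf_diff_mult_diff[OF assms(1), of fst fst]
    expectation_pair_pmf_diff_mult_diff[OF assms(1), of snd snd]
  by (simp add: second_moments_le_def symmetrize_def case_prod_unfold power2_eq_square)

subsection \<open>Cosine moments\<close>

definition cos_moment :: "(real \<times> real) pmf \<Rightarrow> real \<Rightarrow> real \<Rightarrow> real" where
  "cos_moment p a b = measure_pmf.expectation p (\<lambda>z. cos (a * fst z + b * snd z))"

lemma cos_moment_uminus: "cos_moment p (- a) (- b) = cos_moment p a b"
proof -
  have "cos (- a * u + - b * w) = cos (a * u + b * w)" for u w :: real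
    using cos_minus[of "a * u + b * w"] by (simp add: algebra_simps)
  then show ?thesis by (simp add: cos_moment_def)
qed

lemma cos_moment_le_1:
  assumes "finite (set_pmf p)"
  shows "cos_moment p a b \<le> 1"
proof -
  have "cos_moment p a b \<le> measure_pmf.expectation p (\<lambda>_. 1)"
    unfolding cos_moment_def by (intro integral_mono integrable_measure_pmf_finite[OF assms]) simp
  then show ?thesis by simp
qed

lemma cos_moment_diff:
  assumes "finite (set_pmf p)"
  shows "cos_moment p a (- b) - cos_moment p a b =
    2 * measure_pmf.expectation p (\<lambda>z. sin (a * fst z) * sin (b * snd z))"
proof -
  have "cos_moment p a (- b) - cos_moment p a b =
      measure_pmf.expectation p (\<lambda>z. cos (a * fst z + - b * snd z) - cos (a * fst z + b * snd z))"
    unfolding cos_moment_def using integrable_measure_pmf_finite[OF assms]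
    by (intro Bochner_Integration.integral_diff[symmetric]) auto
  also have "\<dots> = 2 * measure_pmf.expectation p (\<lambda>z. sin (a * fst z) * sin (b * snd z))"
    by (simp add: cos_add cos_diff)
  finally show ?thesis .
qed

lemma cos_ge_quadratic: "1 - x\<^sup>2 / 2 \<le> cos (x::real)"
proof -
  have "cos x = 1 - 2 * (sin (x / 2))\<^sup>2"
    using cos_double_sin[of "x / 2"] by simp
  moreover have "(sin (x / 2))\<^sup>2 \<le> (x / 2)\<^sup>2"
    using abs_sin_x_le_abs_x[of "x / 2"] by (simp only: abs_le_square_iff)
  ultimately show ?thesis by (simp add: power_divide)
qed

lemma cos_moment_ge:
  assumes fin: "finite (set_pmf p)" and moments: "second_moments_le p s"
    and ab: "\<bar>a\<bar> \<le> \<epsilon>" "\<bar>b\<bar> \<le> \<epsilon>"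
  shows "1 - 2 * s * \<epsilon>\<^sup>2 \<le> cos_moment p a b"
proof -
  note I = integrable_measure_pmf_finite[OF fin]
  have "a\<^sup>2 \<le> \<epsilon>\<^sup>2" "b\<^sup>2 \<le> \<epsilon>\<^sup>2" using ab by (simp_all flip: abs_le_square_iff)
  then have "a\<^sup>2 * measure_pmf.expectation p (\<lambda>z. (fst z)\<^sup>2) +
      b\<^sup>2 * measure_pmf.expectation p (\<lambda>z. (snd z)\<^sup>2) \<le> \<epsilon>\<^sup>2 * s + \<epsilon>\<^sup>2 * s"
    using moments unfolding second_moments_le_def
    by (intro add_mono mult_mono) (auto intro: Bochner_Integration.integral_nonneg)
  then have "1 - 2 * s * \<epsilon>\<^sup>2 \<le> measure_pmf.expectation p (\<lambda>z. 1 - (a\<^sup>2 * (fst z)\<^sup>2 + b\<^sup>2 * (snd z)\<^sup>2))"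
    by (simp add: I)
  also have "\<dots> \<le> cos_moment p a b"
    unfolding cos_moment_def
  proof (intro integral_mono I)
    fix z :: "real \<times> real"
    have "(a * fst z + b * snd z)\<^sup>2 / 2 \<le> a\<^sup>2 * (fst z)\<^sup>2 + b\<^sup>2 * (snd z)\<^sup>2"
      using zero_le_power2[of "a * fst z - b * snd z"] by (simp add: power2_eq_square algebra_simps)
    then show "1 - (a\<^sup>2 * (fst z)\<^sup>2 + b\<^sup>2 * (snd z)\<^sup>2) \<le> cos (a * fst z + b * snd z)"
      using cos_ge_quadratic[of "a * fst z + b * snd z"] by linarith
  qed
  finally show ?thesis .
qed

lemma tendsto_sin_mult_over: "((\<lambda>\<epsilon>. sin (\<epsilon> * x) / \<epsilon>) \<longlongrightarrow> x) (at_right (0::real))"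
proof -
  have "((\<lambda>\<epsilon>. sin (\<epsilon> * x)) has_real_derivative x) (at_right 0)"
    by (auto intro!: derivative_eq_intros)
  then show ?thesis by (simp add: has_field_derivative_iff)
qed

lemma eventually_expectation_sin_mult_sin_gt:
  fixes p :: "(real \<times> real) pmf"
  assumes fin: "finite (set_pmf p)" and \<kappa>: "\<kappa> < measure_pmf.expectation p (\<lambda>z. fst z * snd z)"
  shows "\<forall>\<^sub>F \<epsilon> in at_right 0.
    \<kappa> * \<epsilon>\<^sup>2 < measure_pmf.expectation p (\<lambda>z. sin (\<epsilon> * fst z) * sin (\<epsilon> * snd z))"
proof -
  have E: "measure_pmf.expectation p h = (\<Sum>z\<in>set_pmf p. h z * pmf p z)" for h :: "real \<times> real \<Rightarrow> real"
    using fin by (intro integral_measure_pmf_real) auto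
  have "((\<lambda>\<epsilon>. \<Sum>z\<in>set_pmf p. (sin (\<epsilon> * fst z) / \<epsilon>) * (sin (\<epsilon> * snd z) / \<epsilon>) * pmf p z) \<longlongrightarrow>
      (\<Sum>z\<in>set_pmf p. fst z * snd z * pmf p z)) (at_right 0)"
    by (intro tendsto_intros tendsto_sin_mult_over)
  then have "\<forall>\<^sub>F \<epsilon> in at_right 0.
      \<kappa> < measure_pmf.expectation p (\<lambda>z. sin (\<epsilon> * fst z) * sin (\<epsilon> * snd z)) / \<epsilon>\<^sup>2"
    using \<kappa> unfolding E by (simp add: order_tendstoD sum_divide_distrib power2_eq_square)
  moreover have "\<forall>\<^sub>F \<epsilon>::real in at_right 0. 0 < \<epsilon>" by (rule eventually_at_right_less)
  ultimately show ?thesis by eventually_elim (simp add: field_simps)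
qed

lemma prod_list_cis: "(\<Prod>x\<leftarrow>xs. cis (f x)) = cis (\<Sum>x\<leftarrow>xs. f x)"
  by (induction xs) (simp_all add: cis_mult)

lemma expectation_cis_eq_cos_moment:
  assumes fin: "finite (set_pmf p)" and sym: "map_pmf uminus p = p"
  shows "measure_pmf.expectation p (\<lambda>z. cis (a * fst z + b * snd z)) =
    complex_of_real (cos_moment p a b)"
proof (rule complex_eqI)
  note integrable_measure_pmf_finite[OF fin, simp]
  show "Re (measure_pmf.expectation p (\<lambda>z. cis (a * fst z + b * snd z))) =
      Re (complex_of_real (cos_moment p a b))"
    by (simp add: cos_moment_def flip: integral_Re)
  have "sin (a * fst (- z) + b * snd (- z)) = - sin (a * fst z + b * snd z)" for z :: "real \<times> real"
    using sin_minus[of "a * fst z + b * snd z"] by (simp add: algebra_simps)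
  then have "measure_pmf.expectation p (\<lambda>z. sin (a * fst z + b * snd z)) = 0"
    by (intro expectation_odd_eq_0 sym)
  then show "Im (measure_pmf.expectation p (\<lambda>z. cis (a * fst z + b * snd z))) =
      Im (complex_of_real (cos_moment p a b))"
    by (simp flip: integral_Im)
qed

lemma expectation_cos_linear_combination:
  assumes fin: "finite (set_pmf p)" and sym: "map_pmf uminus p = p"
  shows "measure_pmf.expectation (replicate_pmf (length cs) p)
      (\<lambda>zs. cos (\<Sum>((a, b), z)\<leftarrow>zip cs zs. a * fst z + b * snd z)) =
    (\<Prod>(a, b)\<leftarrow>cs. cos_moment p a b)"
proof -
  define \<phi>s where "\<phi>s = map (\<lambda>(a, b) z. cis (a * fst z + b * snd z)) cs"
  have "(\<Prod>(\<phi>, z)\<leftarrow>zip \<phi>s zs. \<phi> z) = cis (\<Sum>((a, b), z)\<leftarrow>zip cs zs. a * fst z + b * snd z)" for zs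
    by (simp add: \<phi>s_def zip_map1 case_prod_unfold o_def prod_list_cis)
  moreover have "(\<Prod>\<phi>\<leftarrow>\<phi>s. measure_pmf.expectation p \<phi>) =
      complex_of_real (\<Prod>(a, b)\<leftarrow>cs. cos_moment p a b)"
    unfolding \<phi>s_def by (induction cs) (auto simp: expectation_cis_eq_cos_moment[OF fin sym])
  ultimately have cis: "measure_pmf.expectation (replicate_pmf (length cs) p)
      (\<lambda>zs. cis (\<Sum>((a, b), z)\<leftarrow>zip cs zs. a * fst z + b * snd z)) =
    complex_of_real (\<Prod>(a, b)\<leftarrow>cs. cos_moment p a b)"
    using expectation_replicate_pmf_prod_zip[OF fin, of \<phi>s] by (simp add: \<phi>s_def)
  have "measure_pmf.expectation (replicate_pmf (length cs) p)
      (\<lambda>zs. Re (cis (\<Sum>((a, b), z)\<leftarrow>zip cs zs. a * fst z + b * snd z))) =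
    (\<Prod>(a, b)\<leftarrow>cs. cos_moment p a b)"
    by (subst integral_Re)
      (simp_all add: cis integrable_measure_pmf_finite finite_set_replicate_pmf fin)
  then show ?thesis by simp
qed

definition linear_combination :: "real list \<Rightarrow> real list \<Rightarrow> real" where
  "linear_combination cs us = (\<Sum>(c, u)\<leftarrow>zip cs us. c * u)"

lemma linear_combination_add_scaled:
  "linear_combination (map fst cs) (map fst zs) + r * linear_combination (map snd cs) (map snd zs) =
    (\<Sum>((a, b), z)\<leftarrow>zip (map (map_prod id ((*) r)) cs) zs. a * fst z + b * snd z)"
  by (simp add: linear_combination_def zip_map_map zip_map1 zip_map2 case_prod_unfold o_def
      sum_list_addf sum_list_const_mult mult.assoc)

lemma expectation_sin_mult_sin_linear_combination:
  assumes fin: "finite (set_pmf p)" and sym: "map_pmf uminus p = p"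
  shows "measure_pmf.expectation (iid_views (length cs) p)
      (\<lambda>(us, ws). sin (linear_combination (map fst cs) us) *
        sin (linear_combination (map snd cs) ws)) =
    ((\<Prod>(a, b)\<leftarrow>cs. cos_moment p a (- b)) - (\<Prod>(a, b)\<leftarrow>cs. cos_moment p a b)) / 2"
proof -
  let ?R = "replicate_pmf (length cs) p"
  let ?A = "\<lambda>zs. linear_combination (map fst cs) (map fst zs)"
  let ?B = "\<lambda>zs. linear_combination (map snd cs) (map snd zs)"
  note I = integrable_measure_pmf_finite[OF finite_set_replicate_pmf[OF fin]]
  have cos_moments: "measure_pmf.expectation ?R (\<lambda>zs. cos (?A zs + r * ?B zs)) =
      (\<Prod>(a, b)\<leftarrow>cs. cos_moment p a (r * b))" for r
    using expectation_cos_linear_combination[OF fin sym, of "map (map_prod id ((*) r)) cs"]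
    by (simp add: linear_combination_add_scaled case_prod_unfold o_def)
  have "measure_pmf.expectation ?R (\<lambda>zs. sin (?A zs) * sin (?B zs)) =
      measure_pmf.expectation ?R (\<lambda>zs. (cos (?A zs + (- 1) * ?B zs) - cos (?A zs + 1 * ?B zs)) / 2)"
    by (intro Bochner_Integration.integral_cong) (simp_all add: cos_add cos_diff)
  also have "\<dots> = ((\<Prod>(a, b)\<leftarrow>cs. cos_moment p a (- b)) - (\<Prod>(a, b)\<leftarrow>cs. cos_moment p a b)) / 2"
    using cos_moments[of "- 1"] cos_moments[of 1] by (simp add: I)
  finally show ?thesis by (simp add: iid_views_def)
qed

subsection \<open>Linear combinations with coefficients -1, 0 and 1\<close>

lemma spin_mult_exp_scaled_diff_ge:
  fixes x y d m :: real
  assumes "x = exp d * y" and "m \<le> x" and "m \<le> y" and "0 \<le> m" and "0 \<le> spin v * d"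
  shows "spin v * d * m \<le> spin v * (x - y)"
proof (cases v)
  case True
  have "d * m \<le> d * y" using assms True by (intro mult_left_mono) (auto simp: spin_def)
  also have "\<dots> \<le> (exp d - 1) * y"
    using assms exp_ge_add_one_self[of d] by (intro mult_right_mono) linarith+
  finally show ?thesis using True assms(1) by (simp add: spin_def algebra_simps)
next
  case False
  have y: "y = exp (- d) * x" using assms(1) by (simp flip: exp_add)
  have "- d * m \<le> - d * x" using assms False by (intro mult_left_mono) (auto simp: spin_def)
  also have "\<dots> \<le> (exp (- d) - 1) * x"
    using assms exp_ge_add_one_self[of "- d"] by (intro mult_right_mono) linarith+
  finally show ?thesis using False y by (simp add: spin_def algebra_simps)
qed

lemma cos_moment_sign_flip:
  assumes "a \<in> {-1, 0, 1}" and "b \<in> {-1, 0, 1}"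
    and "0 < cos_moment p \<epsilon> \<epsilon>" and "0 < cos_moment p \<epsilon> (- \<epsilon>)"
  shows "cos_moment p (\<epsilon> * a) (- (\<epsilon> * b)) =
    exp (a * b * (ln (cos_moment p \<epsilon> (- \<epsilon>)) - ln (cos_moment p \<epsilon> \<epsilon>))) *
      cos_moment p (\<epsilon> * a) (\<epsilon> * b)"
  using assms cos_moment_uminus[of p \<epsilon> \<epsilon>] cos_moment_uminus[of p \<epsilon> "- \<epsilon>"]
    cos_moment_uminus[of p \<epsilon> 0] cos_moment_uminus[of p 0 \<epsilon>]
  by (auto simp: exp_diff)

lemma prod_cos_moment_sign_flip:
  assumes "\<And>a b. (a, b) \<in> set cs \<Longrightarrow> a \<in> {-1, 0, 1} \<and> b \<in> {-1, 0, 1}"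
    and "0 < cos_moment p \<epsilon> \<epsilon>" and "0 < cos_moment p \<epsilon> (- \<epsilon>)"
  shows "(\<Prod>(a, b)\<leftarrow>cs. cos_moment p (\<epsilon> * a) (- (\<epsilon> * b))) =
    exp ((\<Sum>(a, b)\<leftarrow>cs. a * b) * (ln (cos_moment p \<epsilon> (- \<epsilon>)) - ln (cos_moment p \<epsilon> \<epsilon>))) *
      (\<Prod>(a, b)\<leftarrow>cs. cos_moment p (\<epsilon> * a) (\<epsilon> * b))"
  using assms(1)
proof (induction cs)
  case (Cons c cs)
  obtain a b where "c = (a, b)" by (cases c)
  then show ?case
    using Cons.IH[OF Cons.prems] Cons.prems[of a b] cos_moment_sign_flip[OF _ _ assms(2,3), of a b]
    by (simp add: distrib_right exp_add)
qed simp

lemma power_length_le_prod_list: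
  fixes t :: real
  assumes "0 \<le> t" and "\<And>x. x \<in> set xs \<Longrightarrow> t \<le> f x"
  shows "t ^ length xs \<le> (\<Prod>x\<leftarrow>xs. f x)"
  using assms(2)
proof (induction xs)
  case (Cons x xs)
  then have "t * t ^ length xs \<le> f x * (\<Prod>x\<leftarrow>xs. f x)"
    using assms(1) by (intro mult_mono) (auto intro: order_trans)
  then show ?case by simp
qed simp

lemma ln_cos_moment_diff_ge:
  assumes fin: "finite (set_pmf p)"
    and "0 < cos_moment p a b" and "cos_moment p a b \<le> cos_moment p a (- b)"
  shows "2 * measure_pmf.expectation p (\<lambda>z. sin (a * fst z) * sin (b * snd z)) \<le>
    ln (cos_moment p a (- b)) - ln (cos_moment p a b)"
proof -
  define x where "x = cos_moment p a (- b)"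
  define y where "y = cos_moment p a b"
  have xy: "0 < y" "y \<le> x" "x \<le> 1"
    using assms(2,3) cos_moment_le_1[OF fin] by (auto simp: x_def y_def)
  have "x - y \<le> (x - y) / x" using xy by (simp add: le_divide_eq mult_left_le)
  also have "\<dots> \<le> ln x - ln y" using ln_diff_le[of y x] xy by (simp add: field_simps)
  finally show ?thesis using cos_moment_diff[OF fin, of a b] by (simp add: x_def y_def)
qed

lemma spin_mult_expectation_sin_mult_sin_ge:
  fixes p :: "(real \<times> real) pmf" and \<epsilon> :: real
  defines "\<tau> \<equiv> measure_pmf.expectation p (\<lambda>z. sin (\<epsilon> * fst z) * sin (\<epsilon> * snd z))"
  assumes fin: "finite (set_pmf p)" and sym: "map_pmf uminus p = p"
    and coeffs: "\<And>a b. (a, b) \<in> set cs \<Longrightarrow> a \<in> {-1, 0, 1} \<and> b \<in> {-1, 0, 1}"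
    and t: "0 < t" "\<And>a b. \<bar>a\<bar> \<le> \<epsilon> \<Longrightarrow> \<bar>b\<bar> \<le> \<epsilon> \<Longrightarrow> t \<le> cos_moment p a b"
    and "0 \<le> \<epsilon>" and "0 \<le> \<tau>" and pos: "0 \<le> spin v * (\<Sum>(a, b)\<leftarrow>cs. a * b)"
  shows "spin v * (\<Sum>(a, b)\<leftarrow>cs. a * b) * \<tau> * t ^ length cs \<le>
    spin v * measure_pmf.expectation (iid_views (length cs) p)
      (\<lambda>(us, ws). sin (linear_combination (map (\<lambda>(a, b). \<epsilon> * a) cs) us) *
        sin (linear_combination (map (\<lambda>(a, b). \<epsilon> * b) cs) ws))"
proof -
  define S where "S = (\<Sum>(a, b)\<leftarrow>cs. a * b)"
  define L where "L = ln (cos_moment p \<epsilon> (- \<epsilon>)) - ln (cos_moment p \<epsilon> \<epsilon>)"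
  define P where "P r = (\<Prod>(a, b)\<leftarrow>cs. cos_moment p (\<epsilon> * a) (r * (\<epsilon> * b)))" for r
  have pos_moments: "0 < cos_moment p \<epsilon> \<epsilon>" "0 < cos_moment p \<epsilon> (- \<epsilon>)"
    using t(2)[of \<epsilon> "- \<epsilon>"] t(2)[of \<epsilon> \<epsilon>] \<open>0 \<le> \<epsilon>\<close> \<open>0 < t\<close> by auto
  have "2 * \<tau> \<le> L"
    using \<open>0 \<le> \<tau>\<close> pos_moments(1) cos_moment_diff[OF fin, of \<epsilon> \<epsilon>]
    unfolding L_def \<tau>_def by (intro ln_cos_moment_diff_ge[OF fin]) auto
  have P_ge: "t ^ length cs \<le> P r" if "\<bar>r\<bar> = 1" for r
    unfolding P_def
  proof (rule power_length_le_prod_list)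
    fix c assume "c \<in> set cs"
    then have "\<bar>fst c\<bar> \<le> 1" "\<bar>snd c\<bar> \<le> 1" using coeffs[of "fst c" "snd c"] by auto
    then show "t \<le> (case c of (a, b) \<Rightarrow> cos_moment p (\<epsilon> * a) (r * (\<epsilon> * b)))"
      using that \<open>0 \<le> \<epsilon>\<close> by (auto simp: case_prod_unfold abs_mult mult_left_le intro!: t(2))
  qed (use t(1) in simp)
  have "P (- 1) = exp (S * L) * P 1"
    using prod_cos_moment_sign_flip[OF coeffs pos_moments] by (simp add: P_def S_def L_def)
  from spin_mult_exp_scaled_diff_ge[OF this P_ge P_ge, of v]
  have "spin v * (S * L) * t ^ length cs \<le> spin v * (P (- 1) - P 1)"
    using pos \<open>2 * \<tau> \<le> L\<close> \<open>0 \<le> \<tau>\<close> t(1) by (simp add: S_def flip: mult.assoc)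
  moreover have "spin v * S * (2 * \<tau>) * t ^ length cs \<le> spin v * S * L * t ^ length cs"
    using pos \<open>2 * \<tau> \<le> L\<close> t(1) by (intro mult_right_mono mult_left_mono) (auto simp: S_def)
  ultimately have "spin v * S * \<tau> * t ^ length cs \<le> spin v * ((P (- 1) - P 1) / 2)" by simp
  also have "(P (- 1) - P 1) / 2 = measure_pmf.expectation (iid_views (length cs) p)
      (\<lambda>(us, ws). sin (linear_combination (map (\<lambda>(a, b). \<epsilon> * a) cs) us) *
        sin (linear_combination (map (\<lambda>(a, b). \<epsilon> * b) cs) ws))"
    using expectation_sin_mult_sin_linear_combination[OF fin sym,
        of "map (map_prod ((*) \<epsilon>) ((*) \<epsilon>)) cs"]
    by (simp add: P_def case_prod_unfold o_def)
  finally show ?thesis by (simp add: S_def)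
qed

subsection \<open>Empirical distributions\<close>

lemma ex_finite_prob_gt:
  fixes p :: "'a pmf" and \<eta> :: real
  assumes "0 < \<eta>"
  shows "\<exists>A. finite A \<and> A \<subseteq> set_pmf p \<and> 1 - \<eta> < measure_pmf.prob p A"
proof -
  have summable: "pmf p summable_on set_pmf p"
    by (rule abs_summable_summable[OF abs_summable_equivalent[THEN iffD2, OF pmf_abs_summable]])
  have "infsum (pmf p) (set_pmf p) = 1"
    using infsetsum_infsum[OF pmf_abs_summable, of p "set_pmf p"] by (simp add: infsetsum_pmf_eq_1)
  with summable have "(pmf p has_sum 1) (set_pmf p)" by (simp only: has_sum_iff)
  then have "\<forall>\<^sub>F A in finite_subsets_at_top (set_pmf p). 1 - \<eta> < sum (pmf p) A"
    unfolding has_sum_def using assms by (intro order_tendstoD) auto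
  then obtain A where "finite A" "A \<subseteq> set_pmf p" "1 - \<eta> < sum (pmf p) A"
    unfolding eventually_finite_subsets_at_top by blast
  then show ?thesis by (auto simp: measure_measure_pmf_finite)
qed

lemma ex_list_with_multiplicities:
  fixes k :: "'a \<Rightarrow> nat"
  assumes "finite A"
  shows "\<exists>xs. set xs \<subseteq> A \<and> (\<forall>h :: 'a \<Rightarrow> real. (\<Sum>x\<leftarrow>xs. h x) = (\<Sum>x\<in>A. real (k x) * h x))"
  using assms
proof (induction A)
  case (insert a A)
  then obtain xs where xs: "set xs \<subseteq> A" "\<And>h :: 'a \<Rightarrow> real. (\<Sum>x\<leftarrow>xs. h x) = (\<Sum>x\<in>A. real (k x) * h x)"
    by blast
  then show ?case
    using insert.hyps by (intro exI[of _ "replicate (k a) a @ xs"]) (auto simp: sum_list_replicate)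
qed simp

lemma abs_expectation_diff_sum_le:
  fixes p :: "'a pmf" and h :: "'a \<Rightarrow> real"
  assumes "finite A" and h: "\<And>x. \<bar>h x\<bar> \<le> 1"
  shows "\<bar>(\<Sum>x\<in>A. pmf p x * h x) - measure_pmf.expectation p h\<bar> \<le> 1 - measure_pmf.prob p A"
proof -
  have I: "integrable p g" if "\<And>x. \<bar>g x\<bar> \<le> 1" for g :: "'a \<Rightarrow> real"
    using that by (intro measure_pmf.integrable_const_bound[of _ 1]) auto
  have "(\<Sum>x\<in>A. pmf p x * h x) = measure_pmf.expectation p (\<lambda>x. h x * indicator A x)"
    using assms(1) by (subst integral_measure_pmf_real[of A])
      (auto intro!: sum.cong simp: indicator_def split: if_splits)
  then have "\<bar>(\<Sum>x\<in>A. pmf p x * h x) - measure_pmf.expectation p h\<bar> =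
      \<bar>measure_pmf.expectation p (\<lambda>x. h x * indicator A x - h x)\<bar>"
    using h by (subst Bochner_Integration.integral_diff) (auto intro!: I simp: indicator_def)
  also have "\<dots> \<le> measure_pmf.expectation p (\<lambda>x. \<bar>h x * indicator A x - h x\<bar>)"
    by (rule integral_abs_bound)
  also have "\<dots> \<le> measure_pmf.expectation p (indicator (- A))"
    using h by (intro integral_mono I) (auto simp: indicator_def)
  also have "\<dots> = 1 - measure_pmf.prob p A"
    using measure_pmf.prob_compl[of A p] by (simp add: Compl_eq_Diff_UNIV)
  finally show ?thesis .
qed

lemma abs_sum_multiplicities_diff_le:
  fixes h k :: "'a \<Rightarrow> real"
  assumes "finite A" and h: "\<And>x. \<bar>h x\<bar> \<le> 1" and k: "\<And>x. \<bar>k x - pmf p x * R\<bar> \<le> 1" and "0 \<le> R"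
  shows "\<bar>(\<Sum>x\<in>A. k x * h x) - R * measure_pmf.expectation p h\<bar> \<le>
    card A + R * (1 - measure_pmf.prob p A)"
proof -
  define S where "S = (\<Sum>x\<in>A. pmf p x * h x)"
  have "\<bar>(\<Sum>x\<in>A. k x * h x) - R * S\<bar> = \<bar>\<Sum>x\<in>A. (k x - pmf p x * R) * h x\<bar>"
    by (simp add: S_def sum_distrib_left algebra_simps sum_subtractf)
  also have "\<dots> \<le> (\<Sum>x\<in>A. \<bar>(k x - pmf p x * R) * h x\<bar>)" by (rule sum_abs)
  also have "\<dots> \<le> (\<Sum>x\<in>A. 1)"
    using k h by (intro sum_mono) (auto simp: abs_mult intro!: mult_le_one)
  finally have "\<bar>(\<Sum>x\<in>A. k x * h x) - R * S\<bar> \<le> card A" by simp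
  moreover have "R * \<bar>S - measure_pmf.expectation p h\<bar> \<le> R * (1 - measure_pmf.prob p A)"
    unfolding S_def using assms by (intro mult_left_mono abs_expectation_diff_sum_le)
  then have "\<bar>R * S - R * measure_pmf.expectation p h\<bar> \<le> R * (1 - measure_pmf.prob p A)"
    using \<open>0 \<le> R\<close> by (simp add: abs_mult flip: right_diff_distrib)
  ultimately show ?thesis by linarith
qed

lemma eventually_ex_empirical_list:
  fixes p :: "'a pmf" and \<eta> :: real
  assumes "0 < \<eta>"
  shows "\<forall>\<^sub>F R in sequentially. \<exists>xs. set xs \<subseteq> set_pmf p \<and> length xs \<le> R \<and>
    (\<forall>h :: 'a \<Rightarrow> real. (\<forall>x. \<bar>h x\<bar> \<le> 1) \<longrightarrow>
      \<bar>(\<Sum>x\<leftarrow>xs. h x) - R * measure_pmf.expectation p h\<bar> \<le> \<eta> * R)"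
proof -
  obtain A where A: "finite A" "A \<subseteq> set_pmf p" "1 - \<eta> / 2 < measure_pmf.prob p A"
    using ex_finite_prob_gt[of "\<eta> / 2" p] assms by auto
  have "\<forall>\<^sub>F R in sequentially. 2 * card A / \<eta> \<le> real R"
    using filterlim_real_sequentially by (auto simp: filterlim_at_top)
  then show ?thesis
  proof eventually_elim
    case (elim R)
    define k where "k x = nat \<lfloor>pmf p x * R\<rfloor>" for x
    have k: "real (k x) \<le> pmf p x * R" "pmf p x * R - 1 \<le> real (k x)" for x by (simp_all add: k_def)
    then have k_diff: "\<bar>k x - pmf p x * R\<bar> \<le> 1" for x by (simp add: abs_le_iff algebra_simps)
    obtain xs where xs: "set xs \<subseteq> A" "\<And>h :: 'a \<Rightarrow> real. (\<Sum>x\<leftarrow>xs. h x) = (\<Sum>x\<in>A. real (k x) * h x)"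
      using ex_list_with_multiplicities[OF A(1)] by blast
    have "real (length xs) = (\<Sum>x\<in>A. real (k x))" using xs(2)[of "\<lambda>_. 1"] by (simp add: sum_list_triv)
    also have "\<dots> \<le> (\<Sum>x\<in>A. pmf p x * R)" by (intro sum_mono k)
    also have "\<dots> = measure_pmf.prob p A * R"
      by (simp add: measure_measure_pmf_finite A(1) sum_distrib_right)
    also have "\<dots> \<le> 1 * real R" by (intro mult_right_mono) auto
    finally have "length xs \<le> R" by simp
    moreover have "\<bar>(\<Sum>x\<leftarrow>xs. h x) - R * measure_pmf.expectation p h\<bar> \<le> \<eta> * R"
      if "\<forall>x. \<bar>h x\<bar> \<le> 1" for h :: "'a \<Rightarrow> real"
    proof -
      have "\<bar>(\<Sum>x\<leftarrow>xs. h x) - R * measure_pmf.expectation p h\<bar> \<le>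
          card A + R * (1 - measure_pmf.prob p A)"
        unfolding xs(2) using that k_diff A(1) by (intro abs_sum_multiplicities_diff_le) auto
      also have "card A \<le> \<eta> / 2 * R" using elim assms by (simp add: field_simps)
      also have "R * (1 - measure_pmf.prob p A) \<le> R * (\<eta> / 2)"
        using A(3) by (intro mult_left_mono) auto
      finally show ?thesis by simp
    qed
    ultimately show ?case using xs(1) A(2) by blast
  qed
qed

subsection \<open>Public-coin protocols as sums of rank-one terms\<close>

lemma public_coin_cc_attainedE:
  assumes "public_coin_cc \<epsilon> f = enat c"
  obtains P where "public_coin_computes \<epsilon> f P" and "\<And>t. t \<in> set_pmf P \<Longrightarrow> height t \<le> c"
proof -
  define C where "C = public_coin_cost ` {P. public_coin_computes \<epsilon> f P}"
  have Inf_C: "Inf C = enat c" using assms by (simp add: public_coin_cc_def C_def)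
  then have "C \<noteq> {}" by (auto simp: Inf_enat_def)
  then have "Inf C \<in> C" unfolding Inf_enat_def using LeastI[of "\<lambda>x. x \<in> C"] by auto
  then obtain P where P: "public_coin_computes \<epsilon> f P" "public_coin_cost P = enat c"
    using Inf_C by (auto simp: C_def)
  have "height t \<le> c" if "t \<in> set_pmf P" for t
  proof -
    have "enat (height t) \<le> public_coin_cost P"
      unfolding public_coin_cost_def using that by (rule SUP_upper)
    then show ?thesis using P by simp
  qed
  then show ?thesis using that P by blast
qed

lemma constant_if_height_0:
  fixes f :: "'x \<times> 'y \<rightharpoonup> bool"
  assumes computes: "public_coin_computes \<epsilon> f P" and "\<epsilon> < 1 / 2"
    and height: "\<And>t. t \<in> set_pmf P \<Longrightarrow> height t = 0"
  shows "\<exists>w. \<forall>x y v. f (x, y) = Some v \<longrightarrow> v = w"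
proof (rule ccontr)
  assume "\<not> ?thesis"
  then obtain x y x' y' where f: "f (x, y) = Some True" "f (x', y') = Some False"
    by (metis (full_types))
  have "run t x y = run t x' y'" if "t \<in> set_pmf P" for t
    using height[OF that] by (cases t) auto
  then have "measure_pmf.prob P {t. run t x' y' = False} = measure_pmf.prob P {t. \<not> run t x y}"
    by (intro measure_pmf.finite_measure_eq_AE AE_pmfI) auto
  moreover have "1 - \<epsilon> \<le> measure_pmf.prob P {t. run t x' y' = False}"
    "1 - \<epsilon> \<le> measure_pmf.prob P {t. run t x y = True}"
    using computes f unfolding public_coin_computes_def by blast+
  ultimately show False using \<open>\<epsilon> < 1 / 2\<close> by (simp add: prob_Collect_not)
qed

primrec rank_one_terms :: "('x, 'y) protocol \<Rightarrow> (('x \<Rightarrow> real) \<times> ('y \<Rightarrow> real)) list" where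
  "rank_one_terms (Answer v) = [(\<lambda>_. 1, \<lambda>_. spin v)]"
| "rank_one_terms (Alice q l r) =
     map (\<lambda>(a, b). (\<lambda>x. of_bool (\<not> q x) * a x, b)) (rank_one_terms l) @
     map (\<lambda>(a, b). (\<lambda>x. of_bool (q x) * a x, b)) (rank_one_terms r)"
| "rank_one_terms (Bob q l r) =
     map (\<lambda>(a, b). (a, \<lambda>y. of_bool (\<not> q y) * b y)) (rank_one_terms l) @
     map (\<lambda>(a, b). (a, \<lambda>y. of_bool (q y) * b y)) (rank_one_terms r)"

lemma sum_rank_one_terms: "(\<Sum>(a, b)\<leftarrow>rank_one_terms t. a x * b y) = spin (run t x y)"
proof (induction t)
  case (Alice q l r)
  then show ?case by (cases "q x") (simp_all add: o_def case_prod_unfold)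
next
  case (Bob q l r)
  then show ?case by (cases "q y") (simp_all add: o_def case_prod_unfold)
qed simp

definition ternary_terms :: "(('x \<Rightarrow> real) \<times> ('y \<Rightarrow> real)) list \<Rightarrow> bool" where
  "ternary_terms terms \<longleftrightarrow> (\<forall>(a, b)\<in>set terms. \<forall>x y. a x \<in> {-1, 0, 1} \<and> b y \<in> {-1, 0, 1})"

lemma ternary_rank_one_terms: "ternary_terms (rank_one_terms t)"
proof -
  have "a x \<in> {-1, 0, 1} \<and> b y \<in> {-1, 0, 1}" if "(a, b) \<in> set (rank_one_terms t)" for a b x y
    using that
  proof (induction t arbitrary: a b)
    case (Answer v)
    then show ?case by (simp add: spin_def)
  next
    case (Alice q l r)
    then show ?case by (cases "q x") fastforce+
  next
    case (Bob q l r)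
    then show ?case by (cases "q y") fastforce+
  qed
  then show ?thesis unfolding ternary_terms_def by blast
qed

lemma length_rank_one_terms: "length (rank_one_terms t) \<le> 2 ^ height t"
proof -
  have "i + j \<le> 2 * 2 ^ max m n" if "i \<le> 2 ^ m" "j \<le> 2 ^ n" for i j m n :: nat
  proof -
    have "(2::nat) ^ m \<le> 2 ^ max m n" "(2::nat) ^ n \<le> 2 ^ max m n" by (auto intro!: power_increasing)
    then show ?thesis using that by linarith
  qed
  then show ?thesis by (induction t) simp_all
qed

lemma eventually_ex_protocol_list:
  fixes f :: "'x \<times> 'y \<rightharpoonup> bool"
  assumes "0 < \<gamma>" and computes: "public_coin_computes ((1 - \<gamma>) / 2) f P"
  shows "\<forall>\<^sub>F R in sequentially. \<exists>ts. set ts \<subseteq> set_pmf P \<and> length ts \<le> R \<and>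
    (\<forall>x y v. f (x, y) = Some v \<longrightarrow> 3 / 4 * \<gamma> * R \<le> spin v * (\<Sum>t\<leftarrow>ts. spin (run t x y)))"
proof -
  have "\<forall>\<^sub>F R in sequentially. \<exists>ts. set ts \<subseteq> set_pmf P \<and> length ts \<le> R \<and>
    (\<forall>h :: _ \<Rightarrow> real. (\<forall>t. \<bar>h t\<bar> \<le> 1) \<longrightarrow>
      \<bar>(\<Sum>t\<leftarrow>ts. h t) - R * measure_pmf.expectation P h\<bar> \<le> \<gamma> / 4 * R)"
    using eventually_ex_empirical_list[of "\<gamma> / 4" P] assms(1) by simp
  then show ?thesis
  proof eventually_elim
    case (elim R)
    then obtain ts where ts: "set ts \<subseteq> set_pmf P" "length ts \<le> R"
      "\<And>h :: _ \<Rightarrow> real. \<forall>t. \<bar>h t\<bar> \<le> 1 \<Longrightarrow>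
        \<bar>(\<Sum>t\<leftarrow>ts. h t) - R * measure_pmf.expectation P h\<bar> \<le> \<gamma> / 4 * R"
      by blast
    have "3 / 4 * \<gamma> * R \<le> spin v * (\<Sum>t\<leftarrow>ts. spin (run t x y))" if f: "f (x, y) = Some v" for x y v
    proof -
      have "\<gamma> \<le> measure_pmf.expectation P (\<lambda>t. spin (run t x y = v))"
        using computes f unfolding expectation_spin_Collect public_coin_computes_def
        by (fastforce simp: field_simps)
      then have "\<gamma> * R \<le> R * measure_pmf.expectation P (\<lambda>t. spin (run t x y = v))"
        by (subst mult.commute) (intro mult_left_mono, auto)
      moreover have "\<bar>(\<Sum>t\<leftarrow>ts. spin (run t x y = v)) -
          R * measure_pmf.expectation P (\<lambda>t. spin (run t x y = v))\<bar> \<le> \<gamma> / 4 * R"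
        by (rule ts(3)) simp
      ultimately have "3 / 4 * \<gamma> * R \<le> (\<Sum>t\<leftarrow>ts. spin (run t x y = v))" by linarith
      also have "\<dots> = spin v * (\<Sum>t\<leftarrow>ts. spin (run t x y))"
        by (simp add: sum_list_const_mult[symmetric] spin_mult eq_commute)
      finally show ?thesis .
    qed
    with ts(1,2) show ?case by blast
  qed
qed

lemma eventually_ex_rank_one_terms:
  fixes f :: "'x \<times> 'y \<rightharpoonup> bool"
  assumes "0 < \<gamma>" and "public_coin_computes ((1 - \<gamma>) / 2) f P"
    and height: "\<And>t. t \<in> set_pmf P \<Longrightarrow> height t \<le> c"
  shows "\<forall>\<^sub>F R in sequentially. \<exists>terms. length terms \<le> R * 2 ^ c \<and> ternary_terms terms \<and>
    (\<forall>x y v. f (x, y) = Some v \<longrightarrow> 3 / 4 * \<gamma> * R \<le> spin v * (\<Sum>(a, b)\<leftarrow>terms. a x * b y))"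
  using eventually_ex_protocol_list[OF assms(1,2)]
proof eventually_elim
  case (elim R)
  then obtain ts where ts: "set ts \<subseteq> set_pmf P" "length ts \<le> R"
    "\<forall>x y v. f (x, y) = Some v \<longrightarrow> 3 / 4 * \<gamma> * R \<le> spin v * (\<Sum>t\<leftarrow>ts. spin (run t x y))"
    by blast
  define terms where "terms = concat (map rank_one_terms ts)"
  have "(\<Sum>(a, b)\<leftarrow>terms. a x * b y) = (\<Sum>t\<leftarrow>ts. spin (run t x y))" for x y
    unfolding terms_def by (induction ts) (simp_all add: sum_rank_one_terms)
  moreover have "ternary_terms terms"
    using ternary_rank_one_terms unfolding terms_def ternary_terms_def by fastforce
  moreover have "length terms \<le> R * 2 ^ c"
  proof -
    have "length (rank_one_terms t) \<le> 2 ^ c" if "t \<in> set ts" for t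
      using ts(1) that by (intro le_trans[OF length_rank_one_terms] power_increasing height) auto
    then have "length terms \<le> length ts * 2 ^ c"
      unfolding terms_def by (induction ts) (auto intro: add_mono)
    also have "\<dots> \<le> R * 2 ^ c" using ts(2) by simp
    finally show ?thesis .
  qed
  ultimately show ?case using ts(3) by auto
qed

subsection \<open>Correlated bits from a public-coin protocol\<close>

definition correlates :: "('x \<times> 'y \<rightharpoonup> bool) \<Rightarrow> ('x \<Rightarrow> 'y \<Rightarrow> (real \<times> real) pmf) \<Rightarrow> real \<Rightarrow> bool" where
  "correlates f K m \<longleftrightarrow> (\<forall>x y v. f (x, y) = Some v \<longrightarrow>
    m \<le> spin v * measure_pmf.expectation (K x y) (\<lambda>(u, w). u * w))"

definition sine_views ::
    "(real \<times> real) pmf \<Rightarrow> real \<Rightarrow> (('x \<Rightarrow> real) \<times> ('y \<Rightarrow> real)) list \<Rightarrow> 'x \<Rightarrow> 'y \<Rightarrow> (real \<times> real) pmf" where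
  "sine_views p \<epsilon> terms x y = map_pmf
    (map_prod (\<lambda>us. sin (linear_combination (map (\<lambda>(a, b). \<epsilon> * a x) terms) us))
      (\<lambda>ws. sin (linear_combination (map (\<lambda>(a, b). \<epsilon> * b y) terms) ws)))
    (iid_views (length terms) p)"

lemma simulates_sine_views:
  fixes terms :: "(('x \<Rightarrow> real) \<times> ('y \<Rightarrow> real)) list"
  assumes "simulates \<nu> (\<lambda>(_ :: 'x) (_ :: 'y). p)"
  shows "simulates \<nu> (sine_views p \<epsilon> terms)"
  unfolding sine_views_def[abs_def] by (intro simulates_map_prod simulates_iid_views_of assms)

lemma sine_views_bounded:
  assumes "(u, w) \<in> set_pmf (sine_views p \<epsilon> terms x y)"
  shows "\<bar>u\<bar> \<le> 1 \<and> \<bar>w\<bar> \<le> 1"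
  using assms by (auto simp: sine_views_def)

lemma spin_mult_expectation_sine_views_ge:
  fixes p :: "(real \<times> real) pmf" and \<epsilon> :: real
  assumes fin: "finite (set_pmf p)" and sym: "map_pmf uminus p = p"
    and moments: "second_moments_le p s"
    and coeffs: "ternary_terms terms"
    and N: "length terms \<le> N" "1 \<le> N" and \<epsilon>: "0 \<le> \<epsilon>" "4 * s * \<epsilon>\<^sup>2 * N \<le> 1"
    and \<kappa>: "0 \<le> \<kappa>" "\<kappa> * \<epsilon>\<^sup>2 \<le> measure_pmf.expectation p (\<lambda>z. sin (\<epsilon> * fst z) * sin (\<epsilon> * snd z))"
    and B: "0 \<le> B" "B \<le> spin v * (\<Sum>(a, b)\<leftarrow>terms. a x * b y)"
  shows "B * (\<kappa> * \<epsilon>\<^sup>2) / 2 \<le>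
    spin v * measure_pmf.expectation (sine_views p \<epsilon> terms x y) (\<lambda>(u, w). u * w)"
proof -
  define t where "t = 1 - 2 * s * \<epsilon>\<^sup>2"
  define cs where "cs = map (\<lambda>(a, b). (a x, b y)) terms"
  define S where "S = spin v * (\<Sum>(a, b)\<leftarrow>cs. a * b)"
  define \<tau> where "\<tau> = measure_pmf.expectation p (\<lambda>z. sin (\<epsilon> * fst z) * sin (\<epsilon> * snd z))"
  have "B \<le> S" "0 \<le> S" using B by (auto simp: S_def cs_def o_def case_prod_unfold)
  have "\<kappa> * \<epsilon>\<^sup>2 \<le> \<tau>" "0 \<le> \<tau>"
    using \<kappa> by (auto simp: \<tau>_def intro: order_trans[of 0 "\<kappa> * \<epsilon>\<^sup>2"])
  have "0 \<le> measure_pmf.expectation p (\<lambda>z. (fst z)\<^sup>2)"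
    by (simp add: Bochner_Integration.integral_nonneg)
  then have "0 \<le> s" using moments unfolding second_moments_le_def by linarith
  have N_small: "2 * s * \<epsilon>\<^sup>2 * k \<le> 1 / 2" if "k \<le> N" for k :: nat
    using mult_left_mono[of "real k" "real N" "2 * s * \<epsilon>\<^sup>2"] that \<epsilon>(2) \<open>0 \<le> s\<close> by simp
  have "0 < t" using N_small[OF N(2)] by (simp add: t_def)
  have "1 / 2 \<le> 1 + real (length cs) * (- (2 * s * \<epsilon>\<^sup>2))"
    using N_small[OF N(1)] by (simp add: cs_def mult_ac)
  also have "\<dots> \<le> t ^ length cs"
    using Bernoulli_inequality[of "- (2 * s * \<epsilon>\<^sup>2)"] \<open>0 < t\<close> by (simp add: t_def)
  finally have "B * (\<kappa> * \<epsilon>\<^sup>2) * (1 / 2) \<le> S * \<tau> * t ^ length cs"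
    using \<open>B \<le> S\<close> \<open>0 \<le> S\<close> \<open>\<kappa> * \<epsilon>\<^sup>2 \<le> \<tau>\<close> \<open>0 \<le> \<tau>\<close> \<kappa>(1) by (intro mult_mono) auto
  also have "\<dots> \<le> spin v * measure_pmf.expectation (iid_views (length cs) p)
      (\<lambda>(us, ws). sin (linear_combination (map (\<lambda>(a, b). \<epsilon> * a) cs) us) *
        sin (linear_combination (map (\<lambda>(a, b). \<epsilon> * b) cs) ws))"
    unfolding \<tau>_def S_def
  proof (rule spin_mult_expectation_sin_mult_sin_ge[OF fin sym])
    show "a \<in> {-1, 0, 1} \<and> b \<in> {-1, 0, 1}" if "(a, b) \<in> set cs" for a b
      using that coeffs by (auto simp: cs_def ternary_terms_def)
    show "t \<le> cos_moment p a b" if "\<bar>a\<bar> \<le> \<epsilon>" "\<bar>b\<bar> \<le> \<epsilon>" for a b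
      unfolding t_def by (rule cos_moment_ge[OF fin moments that])
  qed (use \<open>0 < t\<close> \<epsilon>(1) \<open>0 \<le> \<tau>\<close> \<open>0 \<le> S\<close> in \<open>auto simp: \<tau>_def S_def\<close>)
  finally show ?thesis by (simp add: cs_def sine_views_def o_def case_prod_unfold)
qed

lemma filterlim_inverse_sqrt_at_right:
  assumes "0 < (k :: real)"
  shows "filterlim (\<lambda>n. 1 / sqrt (k * real n)) (at_right 0) sequentially"
  unfolding inverse_eq_divide[symmetric]
  by (rule filterlim_compose[OF filterlim_inverse_at_right_top filterlim_compose[OF sqrt_at_top]])
    (intro filterlim_tendsto_pos_mult_at_top[OF tendsto_const assms] filterlim_real_sequentially)

lemma ex_correlated_sines:
  fixes \<nu> :: "(real \<times> real) pmf" and f :: "'x \<times> 'y \<rightharpoonup> bool"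
  assumes fin: "finite (set_pmf \<nu>)"
    and moments: "second_moments_le \<nu> s"
    and pos: "0 < s" "0 < \<kappa>" "0 < \<gamma>" and cov: "\<kappa> < covariance \<nu> fst snd"
    and computes: "public_coin_computes ((1 - \<gamma>) / 2) f P"
    and height: "\<And>t. t \<in> set_pmf P \<Longrightarrow> height t \<le> c"
  shows "\<exists>K. simulates \<nu> K \<and> (\<forall>x y u w. (u, w) \<in> set_pmf (K x y) \<longrightarrow> \<bar>u\<bar> \<le> 1 \<and> \<bar>w\<bar> \<le> 1) \<and>
    correlates f K (3 * \<gamma> * \<kappa> / (32 * s * 2 ^ c))"
proof -
  define p where "p = symmetrize \<nu>"
  have p: "finite (set_pmf p)" "map_pmf uminus p = p" "second_moments_le p (2 * s)"
    using fin moments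
    by (simp_all add: p_def finite_set_symmetrize map_uminus_symmetrize second_moments_le_symmetrize)
  \<comment> \<open>small enough that, by Bernoulli's inequality, products of cosine moments stay above 1/2\<close>
  define \<epsilon> where "\<epsilon> R = 1 / sqrt (8 * s * 2 ^ c * real R)" for R
  define corr where "corr e \<longleftrightarrow>
    2 * \<kappa> * e\<^sup>2 < measure_pmf.expectation p (\<lambda>z. sin (e * fst z) * sin (e * snd z))" for e
  have "filterlim \<epsilon> (at_right 0) sequentially"
    unfolding \<epsilon>_def[abs_def] using pos(1) by (intro filterlim_inverse_sqrt_at_right) simp
  moreover have "\<forall>\<^sub>F e in at_right 0. corr e"
    unfolding corr_def using cov
    by (intro eventually_expectation_sin_mult_sin_gt p)
      (simp add: p_def expectation_symmetrize_fst_mult_snd fin)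
  ultimately have "\<forall>\<^sub>F R in sequentially. corr (\<epsilon> R)" by (simp add: filterlim_iff)
  then have "\<forall>\<^sub>F R in sequentially. 1 \<le> R \<and> corr (\<epsilon> R) \<and> (\<exists>terms. length terms \<le> R * 2 ^ c \<and>
      ternary_terms terms \<and> (\<forall>x y v. f (x, y) = Some v \<longrightarrow> 3 / 4 * \<gamma> * R \<le> spin v * (\<Sum>(a, b)\<leftarrow>terms. a x * b y)))"
    by (intro eventually_conj eventually_ge_at_top
        eventually_ex_rank_one_terms[OF pos(3) computes height])
  then obtain R terms where R: "1 \<le> R" "corr (\<epsilon> R)" and len: "length terms \<le> R * 2 ^ c"
    and coeffs: "ternary_terms terms"
    and sum: "\<forall>x y v. f (x, y) = Some v \<longrightarrow> 3 / 4 * \<gamma> * R \<le> spin v * (\<Sum>(a, b)\<leftarrow>terms. a x * b y)"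
    using eventually_happens by force
  have \<epsilon>_sq: "(\<epsilon> R)\<^sup>2 = 1 / (8 * s * 2 ^ c * R)" using pos(1) by (simp add: \<epsilon>_def power_divide)
  have advantage: "3 * \<gamma> * \<kappa> / (32 * s * 2 ^ c) = 3 / 4 * \<gamma> * R * (2 * \<kappa> * (\<epsilon> R)\<^sup>2) / 2"
    unfolding \<epsilon>_sq using R(1) pos by (simp add: field_simps)
  have "correlates f (sine_views p (\<epsilon> R) terms) (3 * \<gamma> * \<kappa> / (32 * s * 2 ^ c))"
    unfolding correlates_def advantage
  proof (intro allI impI spin_mult_expectation_sine_views_ge[OF p coeffs len])
    show "4 * (2 * s) * (\<epsilon> R)\<^sup>2 * real (R * 2 ^ c) \<le> 1" unfolding \<epsilon>_sq using R(1) pos by simp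
  qed (use R sum pos in \<open>auto simp: corr_def \<epsilon>_def\<close>)
  moreover have "simulates \<nu> (sine_views p (\<epsilon> R) terms)"
    unfolding p_def by (rule simulates_sine_views[OF simulates_symmetrize])
  ultimately show ?thesis
    by (intro exI[of _ "sine_views p (\<epsilon> R) terms"] conjI allI impI sine_views_bounded)
qed

lemma ex_correlated_bits:
  fixes \<nu> :: "(real \<times> real) pmf" and f :: "'x \<times> 'y \<rightharpoonup> bool"
  assumes fin: "finite (set_pmf \<nu>)"
    and moments: "second_moments_le \<nu> s"
    and pos: "0 < s" "0 < \<kappa>" "0 < \<gamma>" and cov: "\<kappa> < covariance \<nu> fst snd"
    and P: "public_coin_computes ((1 - \<gamma>) / 2) f P" "\<And>t. t \<in> set_pmf P \<Longrightarrow> height t \<le> c"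
  shows "\<exists>D. simulates \<nu> D \<and>
    correlates f (\<lambda>x y. map_pmf (map_prod spin spin) (D x y)) (3 * \<gamma> * \<kappa> / (64 * s * 2 ^ c))"
proof -
  define m where "m = 3 * \<gamma> * \<kappa> / (64 * s * 2 ^ c)"
  have "0 < m" and two_m: "3 * \<gamma> * \<kappa> / (32 * s * 2 ^ c) = 2 * m" using pos by (simp_all add: m_def)
  obtain K :: "'x \<Rightarrow> 'y \<Rightarrow> (real \<times> real) pmf" where K: "simulates \<nu> K"
    "\<forall>x y u w. (u, w) \<in> set_pmf (K x y) \<longrightarrow> \<bar>u\<bar> \<le> 1 \<and> \<bar>w\<bar> \<le> 1" "correlates f K (2 * m)"
    using ex_correlated_sines[OF fin moments pos cov P] unfolding two_m by blast
  have nonconst: "map_pmf fst \<nu> \<noteq> return_pmf a" "map_pmf snd \<nu> \<noteq> return_pmf b" for a b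
    using covariance_eq_0_if_map_pmf_eq_return_pmf[of fst \<nu> a snd]
      covariance_eq_0_if_map_pmf_eq_return_pmf[of snd \<nu> b fst] cov pos(2)
    by (auto simp: covariance_commute[of _ snd])
  obtain D :: "'x \<Rightarrow> 'y \<Rightarrow> (bool \<times> bool) pmf" where D: "simulates \<nu> D"
    "\<And>x y. \<bar>measure_pmf.expectation (D x y) (\<lambda>(a, b). spin a * spin b) -
      measure_pmf.expectation (K x y) (\<lambda>(u, w). u * w)\<bar> \<le> 2 * (m / 2)"
    using ex_simulates_rounding[OF fin nonconst K(1,2) half_gt_zero[OF \<open>0 < m\<close>]] by blast
  have "m \<le> spin v * measure_pmf.expectation (D x y) (\<lambda>(a, b). spin a * spin b)"
    if "f (x, y) = Some v" for x y v
    using K(3) D(2)[of x y] that by (cases v) (force simp: correlates_def spin_def)+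
  then show ?thesis
    using D(1) unfolding m_def correlates_def by (intro exI[of _ D]) (simp add: case_prod_unfold)
qed

subsection \<open>Simultaneous-message protocols with a finite source\<close>

definition has_discrete_smp_protocol ::
    "('s \<times> 't) pmf \<Rightarrow> ('x \<times> 'y \<rightharpoonup> bool) \<Rightarrow> real \<Rightarrow> nat \<Rightarrow> nat \<Rightarrow> bool" where
  "has_discrete_smp_protocol \<nu> f \<delta> k l \<longleftrightarrow>
    (\<exists>D :: 'x \<Rightarrow> 'y \<Rightarrow> (bool list \<times> bool list) pmf. \<exists>referee. simulates \<nu> D \<and>
      (\<forall>x y. \<forall>(as, bs)\<in>set_pmf (D x y). length as = k \<and> length bs = l) \<and>
      (\<forall>x y v. f (x, y) = Some v \<longrightarrow> 1 - \<delta> \<le> measure_pmf.prob (D x y) {(as, bs). referee as bs = v}))"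

lemma has_discrete_smp_protocol_const:
  assumes "\<And>x y v. f (x, y) = Some v \<Longrightarrow> v = w" and "0 \<le> \<delta>"
  shows "has_discrete_smp_protocol \<nu> f \<delta> 0 0"
  unfolding has_discrete_smp_protocol_def
  by (rule exI[of _ "\<lambda>_ _. return_pmf ([], [])"], rule exI[of _ "\<lambda>_ _. w"])
    (use assms in \<open>auto simp: simulates_return\<close>)

lemma has_discrete_smp_protocol_coin_flip:
  fixes \<nu> :: "('s \<times> 't) pmf" and f :: "'x \<times> 'y \<rightharpoonup> bool"
  assumes fin: "finite (set_pmf \<nu>)" and nonconst: "\<And>s. map_pmf fst \<nu> \<noteq> return_pmf s" and "1 / 2 < \<delta>"
  shows "has_discrete_smp_protocol \<nu> f \<delta> 1 0"
proof -
  obtain n W where "\<And>u. \<bar>u\<bar> \<le> 1 \<Longrightarrow>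
      \<bar>measure_pmf.expectation (replicate_pmf n (map_pmf fst \<nu>)) (\<lambda>ss. spin (ss \<in> W u)) - u\<bar> \<le> 2 * \<delta> - 1"
    using ex_randomized_rounding[of "map_pmf fst \<nu>" "2 * \<delta> - 1"] fin nonconst \<open>1 / 2 < \<delta>\<close> by auto
  from this[of 0] have W: "\<bar>2 * measure_pmf.prob (iid_views n \<nu>) {z. fst z \<in> W 0} - 1\<bar> \<le> 2 * \<delta> - 1"
    by (simp add: expectation_spin_Collect vimage_def flip: map_fst_iid_views)
  define D :: "'x \<Rightarrow> 'y \<Rightarrow> (bool list \<times> bool list) pmf" where
    "D x y = map_pmf (map_prod (\<lambda>ss. [ss \<in> W 0]) (\<lambda>_. [])) (iid_views n \<nu>)" for x y
  have "1 - \<delta> \<le> measure_pmf.prob (D x y) {(as, bs). hd as = v}" for x y v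
  proof -
    have "measure_pmf.prob (D x y) {(as, bs). hd as = v} =
        measure_pmf.prob (iid_views n \<nu>) {z. (fst z \<in> W 0) = v}"
      by (simp add: D_def vimage_def case_prod_unfold)
    then show ?thesis using W by (cases v) (auto simp: abs_le_iff prob_Collect_not)
  qed
  moreover have "simulates \<nu> D"
    unfolding D_def by (intro simulates_map_prod simulates_iid_views)
  ultimately show ?thesis
    unfolding has_discrete_smp_protocol_def
    by (intro exI[of _ D] exI[of _ "\<lambda>as bs. hd as"]) (auto simp: D_def)
qed

lemma has_discrete_smp_protocol_majority:
  assumes sim: "simulates \<nu> D" and "0 \<le> m"
    and corr: "correlates f (\<lambda>x y. map_pmf (map_prod spin spin) (D x y)) m"
    and n: "exp (- (m\<^sup>2 * real n / 2)) \<le> \<delta>"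
  shows "has_discrete_smp_protocol \<nu> f \<delta> n n"
proof -
  have "1 - \<delta> \<le> measure_pmf.prob (iid_views n (D x y)) {(as, bs). majority (map2 (=) as bs) = v}"
    if f: "f (x, y) = Some v" for x y v
  proof -
    define agree where "agree = map_pmf (\<lambda>(a, b). a = b) (D x y)"
    have "m \<le> spin v * measure_pmf.expectation agree spin"
      using corr f by (force simp: correlates_def agree_def case_prod_unfold spin_mult)
    then have "1 - \<delta> \<le> measure_pmf.prob (replicate_pmf n agree) {cs. majority cs = v}"
      using prob_majority_ge[OF \<open>0 \<le> m\<close>, of v agree n] n by linarith
    also have "\<dots> = measure_pmf.prob (iid_views n (D x y)) {(as, bs). majority (map2 (=) as bs) = v}"
      by (simp add: agree_def iid_views_def vimage_def zip_map_fst_snd flip: map_replicate_pmf)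
    finally show ?thesis .
  qed
  then show ?thesis
    unfolding has_discrete_smp_protocol_def using simulates_iid_views_of[OF sim, of n] length_iid_views
    by (intro exI[of _ "\<lambda>x y. iid_views n (D x y)"]
        exI[of _ "\<lambda>as bs. majority (map2 (=) as bs)"]) blast
qed

subsection \<open>Reduction to a finite source\<close>

definition dominated_approximation :: "'a measure \<Rightarrow> (nat \<Rightarrow> 'a \<Rightarrow> real) \<Rightarrow> ('a \<Rightarrow> real) \<Rightarrow> bool" where
  "dominated_approximation M fs f \<longleftrightarrow> f \<in> borel_measurable M \<and> (\<forall>i. fs i \<in> borel_measurable M) \<and>
    (\<forall>z\<in>space M. (\<lambda>i. fs i z) \<longlonglongrightarrow> f z \<and> (\<forall>i. \<bar>fs i z\<bar> \<le> 2 * \<bar>f z\<bar>))"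

lemma dominated_approximation_const: "dominated_approximation M (\<lambda>_ _. r) (\<lambda>_. r)"
  by (simp add: dominated_approximation_def)

lemma dominated_approximation_compose:
  assumes "dominated_approximation S fs f" and "X \<in> measurable M S"
  shows "dominated_approximation M (\<lambda>i z. fs i (X z)) (\<lambda>z. f (X z))"
  using assms measurable_space[OF assms(2)]
  by (auto simp: dominated_approximation_def intro: measurable_compose)

lemma ex_simple_dominated_approximation:
  fixes f :: "'a \<Rightarrow> real"
  assumes "f \<in> borel_measurable M"
  shows "\<exists>fs. (\<forall>i. simple_function M (fs i)) \<and> dominated_approximation M fs f"
proof -
  obtain fs where "\<forall>i. simple_function M (fs i)" "\<forall>z\<in>space M. (\<lambda>i. fs i z) \<longlonglongrightarrow> f z"
    "\<forall>i. \<forall>z\<in>space M. dist (fs i z) 0 \<le> 2 * dist (f z) 0"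
    using borel_measurable_implies_sequence_metric[OF assms, of 0] by blast
  then show ?thesis
    using assms by (intro exI[of _ fs])
      (simp add: dominated_approximation_def borel_measurable_simple_function)
qed

lemma tendsto_integral_mult:
  assumes fs: "dominated_approximation M fs f" and gs: "dominated_approximation M gs g"
    and sq: "integrable M (\<lambda>z. (f z)\<^sup>2)" "integrable M (\<lambda>z. (g z)\<^sup>2)"
  shows "(\<lambda>i. integral\<^sup>L M (\<lambda>z. fs i z * gs i z)) \<longlonglongrightarrow> integral\<^sup>L M (\<lambda>z. f z * g z)"
proof (rule integral_dominated_convergence[where w="\<lambda>z. 2 * ((f z)\<^sup>2 + (g z)\<^sup>2)"])
  show "AE z in M. (\<lambda>i. fs i z * gs i z) \<longlonglongrightarrow> f z * g z"
    using fs gs by (auto simp: dominated_approximation_def intro!: tendsto_mult)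
  show "AE z in M. norm (fs i z * gs i z) \<le> 2 * ((f z)\<^sup>2 + (g z)\<^sup>2)" for i
  proof (rule AE_I2)
    fix z assume "z \<in> space M"
    then have "\<bar>fs i z\<bar> * \<bar>gs i z\<bar> \<le> (2 * \<bar>f z\<bar>) * (2 * \<bar>g z\<bar>)"
      using fs gs by (intro mult_mono) (auto simp: dominated_approximation_def)
    also have "\<dots> \<le> 2 * ((f z)\<^sup>2 + (g z)\<^sup>2)"
      using zero_le_power2[of "\<bar>f z\<bar> - \<bar>g z\<bar>"] by (simp add: power2_diff)
    finally show "norm (fs i z * gs i z) \<le> 2 * ((f z)\<^sup>2 + (g z)\<^sup>2)" by (simp add: abs_mult)
  qed
qed (use assms in \<open>auto simp: dominated_approximation_def intro!: borel_measurable_times\<close>)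

lemma (in finite_measure) tendsto_covariance:
  assumes "dominated_approximation M fs f" and "dominated_approximation M gs g"
    and "integrable M (\<lambda>z. (f z)\<^sup>2)" and "integrable M (\<lambda>z. (g z)\<^sup>2)"
  shows "(\<lambda>i. covariance M (fs i) (gs i)) \<longlonglongrightarrow> covariance M f g"
  using tendsto_integral_mult[OF assms]
    tendsto_integral_mult[OF assms(1) dominated_approximation_const[of _ 1] assms(3)]
    tendsto_integral_mult[OF assms(2) dominated_approximation_const[of _ 1] assms(4)]
  unfolding covariance_def by (intro tendsto_diff tendsto_mult) auto

lemma (in finite_measure) ex_simple_functions_covariance_gt:
  fixes F :: "'s \<Rightarrow> real" and G :: "'t \<Rightarrow> real"
  assumes XY: "X \<in> measurable M S" "Y \<in> measurable M T"
    and FG: "F \<in> borel_measurable S" "G \<in> borel_measurable T"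
    and sq: "integrable M (\<lambda>z. (F (X z))\<^sup>2)" "integrable M (\<lambda>z. (G (Y z))\<^sup>2)"
    and F2: "integral\<^sup>L M (\<lambda>z. (F (X z))\<^sup>2) < s" and G2: "integral\<^sup>L M (\<lambda>z. (G (Y z))\<^sup>2) < s"
    and cov: "\<kappa> < covariance M (\<lambda>z. F (X z)) (\<lambda>z. G (Y z))"
  shows "\<exists>F' G'. simple_function S F' \<and> simple_function T G' \<and>
    integral\<^sup>L M (\<lambda>z. (F' (X z))\<^sup>2) < s \<and> integral\<^sup>L M (\<lambda>z. (G' (Y z))\<^sup>2) < s \<and>
    \<kappa> < covariance M (\<lambda>z. F' (X z)) (\<lambda>z. G' (Y z))"
proof -
  obtain Fs where Fs: "\<forall>i. simple_function S (Fs i)" "dominated_approximation S Fs F"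
    using ex_simple_dominated_approximation[OF FG(1)] by blast
  obtain Gs where Gs: "\<forall>i. simple_function T (Gs i)" "dominated_approximation T Gs G"
    using ex_simple_dominated_approximation[OF FG(2)] by blast
  note FX = dominated_approximation_compose[OF Fs(2) XY(1)]
  note GY = dominated_approximation_compose[OF Gs(2) XY(2)]
  have "\<forall>\<^sub>F i in sequentially. integral\<^sup>L M (\<lambda>z. (Fs i (X z))\<^sup>2) < s \<and>
      integral\<^sup>L M (\<lambda>z. (Gs i (Y z))\<^sup>2) < s \<and> \<kappa> < covariance M (\<lambda>z. Fs i (X z)) (\<lambda>z. Gs i (Y z))"
    using tendsto_integral_mult[OF FX FX sq(1,1)] tendsto_integral_mult[OF GY GY sq(2,2)]
      tendsto_covariance[OF FX GY sq] F2 G2 cov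
    unfolding power2_eq_square by (intro eventually_conj order_tendstoD)
  then obtain i where "integral\<^sup>L M (\<lambda>z. (Fs i (X z))\<^sup>2) < s \<and>
      integral\<^sup>L M (\<lambda>z. (Gs i (Y z))\<^sup>2) < s \<and> \<kappa> < covariance M (\<lambda>z. Fs i (X z)) (\<lambda>z. Gs i (Y z))"
    using eventually_happens by force
  then show ?thesis using Fs(1) Gs(1) by blast
qed

lemma (in prob_space) ex_pmf_of_simple_function:
  assumes h: "simple_function M h"
  shows "\<exists>\<nu>. measure_pmf \<nu> = distr M (count_space UNIV) h \<and> finite (set_pmf \<nu>)"
proof -
  have [measurable]: "h \<in> measurable M (count_space UNIV)"
    using h by (rule measurable_simple_function)
  let ?D = "distr M (count_space UNIV) h"
  interpret D: prob_space ?D by (rule prob_space_distr) simp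
  have fin: "finite (h ` space M)" using h by (simp add: simple_function_def)
  have range: "AE v in ?D. v \<in> h ` space M" by (subst AE_distr_iff) auto
  define V where "V = {v \<in> h ` space M. measure ?D {v} = 0}"
  have "(\<Union>v\<in>V. {v}) \<in> null_sets ?D"
    using fin by (intro null_sets_UN')
      (auto simp: V_def null_sets_def D.emeasure_eq_measure intro!: countable_finite)
  then have "AE v in ?D. v \<notin> V" using AE_not_in by fastforce
  with range have "AE v in ?D. measure ?D {v} \<noteq> 0" by eventually_elim (auto simp: V_def)
  then have \<nu>: "measure_pmf (Abs_pmf ?D) = ?D"
    using D.prob_space_axioms by (intro Abs_pmf_inverse) auto
  then have "set_pmf (Abs_pmf ?D) \<subseteq> h ` space M"
    using range by (metis (no_types, lifting) AE_measure_pmf_iff subsetI)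
  with \<nu> fin show ?thesis by (auto intro: finite_subset)
qed

lemma simple_function_map_prod:
  assumes sets: "sets \<mu> = sets (S \<Otimes>\<^sub>M T)" and F: "simple_function S F" and G: "simple_function T G"
  shows "simple_function \<mu> (map_prod F G)"
proof -
  have "simple_function \<mu> (\<lambda>z. F (fst z))" "simple_function \<mu> (\<lambda>z. G (snd z))"
    by (rule simple_function_comp[OF _ F] simple_function_comp[OF _ G],
        simp add: measurable_cong_sets[OF sets refl])+
  from simple_function_compose2[OF this, of Pair] show ?thesis
    by (simp add: map_prod_def case_prod_unfold)
qed

lemma ex_finite_source:
  fixes S :: "'a measure" and T :: "'b measure" and \<mu> :: "('a \<times> 'b) measure"
  assumes \<mu>: "prob_space \<mu>" "sets \<mu> = sets (S \<Otimes>\<^sub>M T)"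
    and \<kappa>: "ereal \<kappa> < maximal_correlation S T \<mu>" and "1 < s"
  obtains F G and \<nu> :: "(real \<times> real) pmf" where "simple_function S F" and "simple_function T G"
    and "finite (set_pmf \<nu>)" and "measure_pmf \<nu> = distr \<mu> (count_space UNIV) (map_prod F G)"
    and "second_moments_le \<nu> s"
    and "\<kappa> < covariance \<nu> fst snd"
proof -
  interpret prob_space \<mu> by fact
  obtain F G where FG: "F \<in> borel_measurable S" "G \<in> borel_measurable T"
    and std: "standardized \<mu> (\<lambda>z. F (fst z))" "standardized \<mu> (\<lambda>z. G (snd z))"
    and cov: "\<kappa> < expectation (\<lambda>z. F (fst z) * G (snd z))"
    using \<kappa> unfolding maximal_correlation_def less_SUP_iff by auto
  have proj: "fst \<in> measurable \<mu> S" "snd \<in> measurable \<mu> T"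
    by (simp_all add: measurable_cong_sets[OF \<mu>(2) refl])
  obtain F' G' where F'G': "simple_function S F'" "simple_function T G'"
    "expectation (\<lambda>z. (F' (fst z))\<^sup>2) < s" "expectation (\<lambda>z. (G' (snd z))\<^sup>2) < s"
    "\<kappa> < covariance \<mu> (\<lambda>z. F' (fst z)) (\<lambda>z. G' (snd z))"
    using ex_simple_functions_covariance_gt[OF proj FG, of s \<kappa>] std cov \<open>1 < s\<close>
    by (auto simp: standardized_def covariance_def)
  have h: "simple_function \<mu> (map_prod F' G')"
    by (rule simple_function_map_prod[OF \<mu>(2) F'G'(1,2)])
  then obtain \<nu> where \<nu>: "measure_pmf \<nu> = distr \<mu> (count_space UNIV) (map_prod F' G')"
    "finite (set_pmf \<nu>)"
    using ex_pmf_of_simple_function by blast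
  have E: "measure_pmf.expectation \<nu> g = expectation (\<lambda>z. g (map_prod F' G' z))" for g :: "_ \<Rightarrow> real"
    unfolding \<nu>(1) by (rule integral_distr) (auto intro: measurable_simple_function[OF h])
  show ?thesis
    by (rule that[OF F'G'(1,2) \<nu>(2,1)])
      (use F'G'(3-5) in \<open>simp_all add: E covariance_def second_moments_le_def\<close>)
qed

lemma simple_function_PiM_map:
  assumes "simple_function M h"
  shows "simple_function (PiM {..<N} (\<lambda>_. M)) (\<lambda>\<omega>. map (\<lambda>i. h (\<omega> i)) [0..<N])"
proof -
  have "simple_function (PiM {..<N} (\<lambda>_. M)) (\<lambda>\<omega>. map (\<lambda>i. h (\<omega> i)) js)"
    if "set js \<subseteq> {..<N}" for js
    using that
  proof (induction js)
    case (Cons i js)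
    have "simple_function (PiM {..<N} (\<lambda>_. M)) (\<lambda>\<omega>. h (\<omega> i))"
      using Cons.prems by (intro simple_function_comp[OF _ assms] measurable_component_singleton) auto
    then have "simple_function (PiM {..<N} (\<lambda>_. M)) (\<lambda>\<omega>. h (\<omega> i) # map (\<lambda>i. h (\<omega> i)) js)"
      using Cons by (intro simple_function_compose2[where h="(#)"]) auto
    then show ?case by simp
  qed simp
  from this[of "[0..<N]"] show ?thesis by (simp add: atLeast0LessThan)
qed

lemma vimage_map_upt_Int_space_PiM:
  assumes "length vs = N"
  shows "(\<lambda>\<omega>. map (\<lambda>i. h (\<omega> i)) [0..<N]) -` {vs} \<inter> space (PiM {..<N} (\<lambda>_. M)) =
    (\<Pi>\<^sub>E i\<in>{..<N}. h -` {vs ! i} \<inter> space M)"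
proof -
  have "map (\<lambda>i. h (\<omega> i)) [0..<N] = vs \<longleftrightarrow> (\<forall>i<N. h (\<omega> i) = vs ! i)" for \<omega>
    using assms by (auto simp: list_eq_iff_nth_eq)
  then show ?thesis by (auto simp: space_PiM PiE_iff)
qed

lemma (in prob_space) distr_PiM_eq_replicate_pmf:
  assumes h: "simple_function M h" and \<nu>: "measure_pmf \<nu> = distr M (count_space UNIV) h"
  shows "distr (PiM {..<N} (\<lambda>_. M)) (count_space UNIV) (\<lambda>\<omega>. map (\<lambda>i. h (\<omega> i)) [0..<N]) =
    measure_pmf (replicate_pmf N \<nu>)"
proof -
  interpret P: finite_product_prob_space "\<lambda>_::nat. M" "{..<N}"
    by unfold_locales simp
  let ?P = "PiM {..<N} (\<lambda>_. M)"
  let ?H = "\<lambda>\<omega>. map (\<lambda>i. h (\<omega> i)) [0..<N]"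
  note [measurable] = measurable_simple_function[OF h]
    measurable_simple_function[OF simple_function_PiM_map[OF h]]
  obtain q where q: "measure_pmf q = distr ?P (count_space UNIV) ?H"
    using P.P.ex_pmf_of_simple_function[OF simple_function_PiM_map[OF h]] by blast
  have "q = replicate_pmf N \<nu>"
  proof (rule pmf_eqI)
    fix vs
    have "pmf q vs = measure ?P (?H -` {vs} \<inter> space ?P)"
      by (simp add: pmf.rep_eq q measure_distr)
    also have "\<dots> = pmf (replicate_pmf N \<nu>) vs"
    proof (cases "length vs = N")
      case True
      have "measure ?P (?H -` {vs} \<inter> space ?P) = (\<Prod>i<N. prob (h -` {vs ! i} \<inter> space M))"
        unfolding vimage_map_upt_Int_space_PiM[OF True] by (rule P.prob_times) auto
      also have "\<dots> = (\<Prod>i<N. pmf \<nu> (vs ! i))" by (simp add: pmf.rep_eq \<nu> measure_distr)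
      also have "\<dots> = (\<Prod>x\<leftarrow>vs. pmf \<nu> x)"
        using True by (simp add: prod.list_conv_set_nth atLeast0LessThan)
      finally show ?thesis using True by (simp add: pmf_replicate_pmf)
    next
      case False
      then have "?H -` {vs} = {}" by auto
      then show ?thesis using False by (simp add: pmf_replicate_pmf)
    qed
    finally show "pmf q vs = pmf (replicate_pmf N \<nu>) vs" .
  qed
  then show ?thesis using q by simp
qed

lemma (in prob_space) prob_PiM_eq_replicate_pmf:
  assumes h: "simple_function M h" and \<nu>: "measure_pmf \<nu> = distr M (count_space UNIV) h"
  shows "measure (PiM {..<N} (\<lambda>_. M))
      {\<omega> \<in> space (PiM {..<N} (\<lambda>_. M)). map (\<lambda>i. h (\<omega> i)) [0..<N] \<in> A} =
    measure_pmf.prob (replicate_pmf N \<nu>) A"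
proof -
  have "(\<lambda>\<omega>. map (\<lambda>i. h (\<omega> i)) [0..<N]) \<in> measurable (PiM {..<N} (\<lambda>_. M)) (count_space UNIV)"
    by (rule measurable_simple_function[OF simple_function_PiM_map[OF h]])
  then show ?thesis
    unfolding distr_PiM_eq_replicate_pmf[OF assms, symmetric]
    by (simp add: measure_distr vimage_def Int_def conj_commute)
qed

text \<open>
  A simulation fixes the lengths of the messages only almost surely; padding makes them the same for
  all sample sequences.
\<close>

definition pad :: "nat \<Rightarrow> bool list \<Rightarrow> bool list" where
  "pad n bs = take n (bs @ replicate n False)"

lemma length_pad: "length (pad n bs) = n"
  by (simp add: pad_def)

lemma pad_id: "length bs = n \<Longrightarrow> pad n bs = bs"
  by (simp add: pad_def)

lemma has_discrete_smp_protocolE: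
  fixes \<nu> :: "('s \<times> 't) pmf" and f :: "'x \<times> 'y \<rightharpoonup> bool"
  assumes "has_discrete_smp_protocol \<nu> f \<delta> k l"
  obtains N referee and \<alpha> :: "'x \<Rightarrow> 's list \<Rightarrow> bool list" and \<beta> :: "'y \<Rightarrow> 't list \<Rightarrow> bool list"
  where "\<And>x ss. length (\<alpha> x ss) = k" and "\<And>y ts. length (\<beta> y ts) = l"
    and "\<And>x y v. f (x, y) = Some v \<Longrightarrow> 1 - \<delta> \<le>
      measure_pmf.prob (replicate_pmf N \<nu>) {zs. referee (\<alpha> x (map fst zs)) (\<beta> y (map snd zs)) = v}"
proof -
  obtain D :: "'x \<Rightarrow> 'y \<Rightarrow> (bool list \<times> bool list) pmf" and referee where sim: "simulates \<nu> D"
    and len: "\<forall>x y. \<forall>(as, bs)\<in>set_pmf (D x y). length as = k \<and> length bs = l"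
    and correct: "\<forall>x y v. f (x, y) = Some v \<longrightarrow>
      1 - \<delta> \<le> measure_pmf.prob (D x y) {(as, bs). referee as bs = v}"
    using assms unfolding has_discrete_smp_protocol_def by blast
  obtain N \<alpha> \<beta> where D: "\<And>x y. D x y = map_pmf (map_prod (\<alpha> x) (\<beta> y)) (iid_views N \<nu>)"
    using sim unfolding simulates_def by blast
  have "1 - \<delta> \<le> measure_pmf.prob (replicate_pmf N \<nu>)
      {zs. referee (pad k (\<alpha> x (map fst zs))) (pad l (\<beta> y (map snd zs))) = v}"
    if "f (x, y) = Some v" for x y v
  proof -
    have "pad k (\<alpha> x (map fst zs)) = \<alpha> x (map fst zs) \<and> pad l (\<beta> y (map snd zs)) = \<beta> y (map snd zs)"
      if "zs \<in> set_pmf (replicate_pmf N \<nu>)" for zs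
      using len[rule_format, of "(\<alpha> x (map fst zs), \<beta> y (map snd zs))" x y] that
      by (auto simp: D iid_views_def intro!: pad_id)
    then have "measure_pmf.prob (replicate_pmf N \<nu>)
        {zs. referee (pad k (\<alpha> x (map fst zs))) (pad l (\<beta> y (map snd zs))) = v} =
      measure_pmf.prob (replicate_pmf N \<nu>) {zs. referee (\<alpha> x (map fst zs)) (\<beta> y (map snd zs)) = v}"
      by (intro measure_pmf.finite_measure_eq_AE AE_pmfI) auto
    then show ?thesis using correct that by (simp add: D iid_views_def vimage_def)
  qed
  then show ?thesis by (rule that[OF length_pad length_pad])
qed

lemma has_smp_protocol_if_discrete:
  fixes S :: "'a measure" and T :: "'b measure" and \<mu> :: "('a \<times> 'b) measure"
    and F :: "'a \<Rightarrow> 's" and G :: "'b \<Rightarrow> 't" and f :: "'x \<times> 'y \<rightharpoonup> bool"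
  assumes \<mu>: "prob_space \<mu>" "sets \<mu> = sets (S \<Otimes>\<^sub>M T)"
    and F: "simple_function S F" and G: "simple_function T G"
    and \<nu>: "measure_pmf \<nu> = distr \<mu> (count_space UNIV) (map_prod F G)"
    and protocol: "has_discrete_smp_protocol \<nu> f \<delta> k l"
  shows "has_smp_protocol S T \<mu> f \<delta> (k + l)"
proof -
  interpret prob_space \<mu> by fact
  obtain N referee and \<alpha> :: "'x \<Rightarrow> 's list \<Rightarrow> bool list" and \<beta> :: "'y \<Rightarrow> 't list \<Rightarrow> bool list"
    where len: "\<And>x ss. length (\<alpha> x ss) = k" "\<And>y ts. length (\<beta> y ts) = l"
    and correct: "\<And>x y v. f (x, y) = Some v \<Longrightarrow> 1 - \<delta> \<le>
      measure_pmf.prob (replicate_pmf N \<nu>) {zs. referee (\<alpha> x (map fst zs)) (\<beta> y (map snd zs)) = v}"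
    using protocol by (rule has_discrete_smp_protocolE) blast
  define alice where "alice x s = \<alpha> x (map (\<lambda>i. F (s i)) [0..<N])" for x s
  define bob where "bob y t = \<beta> y (map (\<lambda>i. G (t i)) [0..<N])" for y t
  have "alice x \<in> measurable (PiM {..<N} (\<lambda>_. S)) (count_space UNIV)" for x
    unfolding alice_def
    by (rule measurable_simple_function simple_function_compose1[OF simple_function_PiM_map[OF F]])+
  moreover have "bob y \<in> measurable (PiM {..<N} (\<lambda>_. T)) (count_space UNIV)" for y
    unfolding bob_def
    by (rule measurable_simple_function simple_function_compose1[OF simple_function_PiM_map[OF G]])+
  moreover have "1 - \<delta> \<le> measure (PiM {..<N} (\<lambda>_. \<mu>)) {\<omega> \<in> space (PiM {..<N} (\<lambda>_. \<mu>)).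
      referee (alice x (\<lambda>i\<in>{..<N}. fst (\<omega> i))) (bob y (\<lambda>i\<in>{..<N}. snd (\<omega> i))) = v}"
    if f: "f (x, y) = Some v" for x y v
  proof -
    define A where "A = {zs. referee (\<alpha> x (map fst zs)) (\<beta> y (map snd zs)) = v}"
    have views: "map (\<lambda>i. F ((\<lambda>i\<in>{..<N}. fst (\<omega> i)) i)) [0..<N] = map (\<lambda>i. F (fst (\<omega> i))) [0..<N]"
      "map (\<lambda>i. G ((\<lambda>i\<in>{..<N}. snd (\<omega> i)) i)) [0..<N] = map (\<lambda>i. G (snd (\<omega> i))) [0..<N]" for \<omega>
      by simp_all
    have "1 - \<delta> \<le> measure_pmf.prob (replicate_pmf N \<nu>) A" unfolding A_def by (rule correct[OF f])
    also have "\<dots> = measure (PiM {..<N} (\<lambda>_. \<mu>))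
        {\<omega> \<in> space (PiM {..<N} (\<lambda>_. \<mu>)). map (\<lambda>i. map_prod F G (\<omega> i)) [0..<N] \<in> A}"
      by (rule prob_PiM_eq_replicate_pmf[OF simple_function_map_prod[OF \<mu>(2) F G] \<nu>, symmetric])
    also have "{\<omega> \<in> space (PiM {..<N} (\<lambda>_. \<mu>)). map (\<lambda>i. map_prod F G (\<omega> i)) [0..<N] \<in> A} =
      {\<omega> \<in> space (PiM {..<N} (\<lambda>_. \<mu>)).
        referee (alice x (\<lambda>i\<in>{..<N}. fst (\<omega> i))) (bob y (\<lambda>i\<in>{..<N}. snd (\<omega> i))) = v}"
      by (simp add: A_def alice_def bob_def o_def views del: restrict_apply)
    finally show ?thesis .
  qed
  ultimately show ?thesis
    unfolding has_smp_protocol_def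
    by (intro exI[of _ N] exI[of _ k] exI[of _ l] exI[of _ alice] exI[of _ bob] exI[of _ referee])
      (simp add: alice_def bob_def len)
qed

subsection \<open>The number of bits\<close>

lemma ex_majority_size:
  fixes m \<delta> :: real
  assumes "0 < m" and "m \<le> 1" and "0 < \<delta>" and "\<delta> \<le> 1 / 2"
  shows "\<exists>n. exp (- (m\<^sup>2 * real n / 2)) \<le> \<delta> \<and> real n \<le> 3 * log 2 (1 / \<delta>) / m\<^sup>2"
proof -
  define n where "n = nat \<lceil>2 * ln (1 / \<delta>) / m\<^sup>2\<rceil>"
  have n: "2 * ln (1 / \<delta>) / m\<^sup>2 \<le> real n" "real n \<le> 2 * ln (1 / \<delta>) / m\<^sup>2 + 1"
    using assms(3,4) by (auto simp: n_def real_nat_ceiling_ge of_nat_nat)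
  have "ln (1 / \<delta>) \<le> m\<^sup>2 * real n / 2" using n(1) \<open>0 < m\<close> by (simp add: field_simps)
  then have "exp (- (m\<^sup>2 * real n / 2)) \<le> exp (- ln (1 / \<delta>))" by simp
  also have "\<dots> = \<delta>" using \<open>0 < \<delta>\<close> by (simp add: ln_div)
  finally have "exp (- (m\<^sup>2 * real n / 2)) \<le> \<delta>" .
  moreover have "real n \<le> 3 * log 2 (1 / \<delta>) / m\<^sup>2"
  proof -
    have L: "1 \<le> log 2 (1 / \<delta>)" using assms(3,4) by (simp add: le_log_iff field_simps)
    have "ln (1 / \<delta>) = ln 2 * log 2 (1 / \<delta>)" by (simp add: log_def)
    also have "\<dots> \<le> 1 * log 2 (1 / \<delta>)" using L ln_2_less_1 by (intro mult_right_mono) auto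
    finally have "2 * ln (1 / \<delta>) / m\<^sup>2 \<le> 2 * log 2 (1 / \<delta>) / m\<^sup>2" by (simp add: divide_right_mono)
    moreover have "1 \<le> log 2 (1 / \<delta>) / m\<^sup>2"
      using L assms(1,2) power_le_one[of m 2] by (simp add: le_divide_eq)
    ultimately show ?thesis using n(2) by simp
  qed
  ultimately show ?thesis by blast
qed

lemma ex_majority_protocol_bits:
  fixes \<rho> \<delta> :: real
  assumes "0 < \<rho>" and "\<rho> \<le> 1" and "0 < \<delta>" and "\<delta> \<le> 1 / 2" and "1 \<le> c"
  shows "\<exists>n. exp (- ((\<rho> / (128 * 2 ^ c))\<^sup>2 * real n / 2)) \<le> \<delta> \<and>
    real (n + n) \<le> 2 ^ (20 * c) * log 2 (1 / \<delta>) / \<rho>\<^sup>2"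
proof -
  define m where "m = \<rho> / (128 * 2 ^ c)"
  define L where "L = log 2 (1 / \<delta>)"
  have "\<rho> \<le> 128 * 2 ^ c" using assms(2) one_le_power[of "2::real" c] by linarith
  then have "0 < m" "m \<le> 1" using assms(1) by (simp_all add: m_def)
  then obtain n where n: "exp (- (m\<^sup>2 * real n / 2)) \<le> \<delta>" "real n \<le> 3 * L / m\<^sup>2"
    using ex_majority_size[OF _ _ assms(3,4)] unfolding L_def by blast
  have "0 \<le> L" using assms(3,4) by (simp add: L_def)
  have "real (n + n) \<le> 6 * L / m\<^sup>2" using n(2) by simp
  also have "\<dots> = 6 * 2 ^ (14 + 2 * c) * (L / \<rho>\<^sup>2)"
    by (simp add: m_def power_divide power_mult_distrib power_add mult.commute flip: power_mult)
  also have "\<dots> \<le> 2 ^ (17 + 2 * c) * (L / \<rho>\<^sup>2)"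
    using \<open>0 \<le> L\<close> by (intro mult_right_mono) (simp_all add: power_add)
  also have "\<dots> \<le> 2 ^ (20 * c) * (L / \<rho>\<^sup>2)"
    using \<open>0 \<le> L\<close> assms(5) by (intro mult_right_mono power_increasing) auto
  finally show ?thesis using n(1) unfolding m_def L_def by auto
qed

lemma ex_discrete_smp_protocol:
  fixes \<nu> :: "(real \<times> real) pmf" and f :: "'x \<times> 'y \<rightharpoonup> bool"
  assumes fin: "finite (set_pmf \<nu>)"
    and moments: "second_moments_le \<nu> (3 / 2)"
    and cov: "3 / 4 * \<rho> < covariance \<nu> fst snd" and \<rho>: "0 < \<rho>" "\<rho> \<le> 1" and "0 < \<delta>"
    and P: "public_coin_computes (1 / 3) f P" "\<And>t. t \<in> set_pmf P \<Longrightarrow> height t \<le> c"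
  shows "\<exists>k l. has_discrete_smp_protocol \<nu> f \<delta> k l \<and>
    real (k + l) \<le> max 1 (2 ^ (20 * c) * log 2 (1 / \<delta>) / \<rho>\<^sup>2)"
proof -
  consider (no_bits) "c = 0" | (coin_flip) "1 / 2 < \<delta>" | (majority) "1 \<le> c" "\<delta> \<le> 1 / 2"
    by linarith
  then show ?thesis
  proof cases
    case no_bits
    then obtain w where "\<forall>x y v. f (x, y) = Some v \<longrightarrow> v = w"
      using constant_if_height_0[OF P(1)] P(2) by auto
    then have "has_discrete_smp_protocol \<nu> f \<delta> 0 0"
      using \<open>0 < \<delta>\<close> by (intro has_discrete_smp_protocol_const[of f w]) simp_all
    then show ?thesis by (intro exI[of _ 0]) simp
  next
    case coin_flip
    have "map_pmf fst \<nu> \<noteq> return_pmf s" for s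
      using covariance_eq_0_if_map_pmf_eq_return_pmf[of fst \<nu> s snd] cov \<rho>(1) by auto
    then have "has_discrete_smp_protocol \<nu> f \<delta> 1 0"
      using coin_flip by (intro has_discrete_smp_protocol_coin_flip fin)
    then show ?thesis by (intro exI[of _ 1] exI[of _ 0]) simp
  next
    case majority
    obtain D where "simulates \<nu> D" and
      "correlates f (\<lambda>x y. map_pmf (map_prod spin spin) (D x y)) (\<rho> / (128 * 2 ^ c))"
      using ex_correlated_bits[OF fin moments _ _ _ cov, of "1 / 3" f P c] P \<rho>(1) by auto
    moreover obtain n where "exp (- ((\<rho> / (128 * 2 ^ c))\<^sup>2 * real n / 2)) \<le> \<delta>"
      and n: "real (n + n) \<le> 2 ^ (20 * c) * log 2 (1 / \<delta>) / \<rho>\<^sup>2"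
      using ex_majority_protocol_bits[OF \<rho> \<open>0 < \<delta>\<close> majority(2,1)] by blast
    ultimately have "has_discrete_smp_protocol \<nu> f \<delta> n n"
      using \<rho>(1) by (intro has_discrete_smp_protocol_majority[where m = "\<rho> / (128 * 2 ^ c)"]) auto
    then show ?thesis using n by (intro exI[of _ n]) simp
  qed
qed

theorem theoremD1:
  fixes S :: "'a measure" and T :: "'b measure" and \<mu> :: "('a \<times> 'b) measure"
    and f :: "'x \<times> 'y \<rightharpoonup> bool" and \<rho> \<delta> :: real and c :: nat
  assumes "prob_space \<mu>" and "sets \<mu> = sets (S \<Otimes>\<^sub>M T)"
    and "0 < \<rho>" and "\<rho> \<le> 1"
    and "maximal_correlation S T \<mu> = ereal \<rho>"
    and "public_coin_cc (1/3) f = enat c"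
    and "0 < \<delta>"
  shows "\<exists>bits. has_smp_protocol S T \<mu> f \<delta> bits \<and>
           real bits \<le> max 1 (2 ^ (20 * c) * log 2 (1 / \<delta>) / \<rho>\<^sup>2)"
proof -
  obtain P where P: "public_coin_computes (1 / 3) f P" "\<And>t. t \<in> set_pmf P \<Longrightarrow> height t \<le> c"
    using public_coin_cc_attainedE[OF assms(6)] by blast
  have "ereal (3 / 4 * \<rho>) < maximal_correlation S T \<mu>" using assms(3,5) by simp
  then obtain F G and \<nu> :: "(real \<times> real) pmf"
    where F: "simple_function S F" and G: "simple_function T G"
    and fin: "finite (set_pmf \<nu>)" and \<nu>: "measure_pmf \<nu> = distr \<mu> (count_space UNIV) (map_prod F G)"
    and moments: "second_moments_le \<nu> (3 / 2)"
    and cov: "3 / 4 * \<rho> < covariance \<nu> fst snd"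
    by (rule ex_finite_source[OF assms(1,2), where s = "3 / 2"]) (simp, blast)
  obtain k l where protocol: "has_discrete_smp_protocol \<nu> f \<delta> k l"
    and bits: "real (k + l) \<le> max 1 (2 ^ (20 * c) * log 2 (1 / \<delta>) / \<rho>\<^sup>2)"
    using ex_discrete_smp_protocol[OF fin moments cov assms(3,4,7) P] by blast
  from has_smp_protocol_if_discrete[OF assms(1,2) F G \<nu> protocol] bits show ?thesis by blast
qed

end
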